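(* Let $p\in S_n$ be a pattern avoiding $1324$. If $p$ is $f$-incompatible, then for at least one choice of $q$ among $p,\ p^{-1},\ p^{\mathrm{rc}},\ (p^{\mathrm{rc}})^{-1}$, one of the following conditions holds: (a) $\mathrm{comp}(q)\ge 3$. (b) $\mathrm{comp}(q\smallsetminus q_1)>\mathrm{comp}(q)$. (c) $q_1>1$, $\mathrm{comp}(q)=2$, and the first component of $q$ begins with its largest entry. Furthermore, if $q$ is chosen as $p^{\mathrm{rc}}$ or $(p^{\mathrm{rc}})^{-1}$, then $q_n<n$. (d) $1<q_1<n$ and $q\smallsetminus q_1$ avoids $213$.
   Context: Notation. $\mathrm{Av}(B)$ is the set of permutations avoiding all patterns in $B$ (no subsequence order-isomorphic to a pattern in $B$). For $\pi\in S_n$ and a value $e\in[n]$, $\pi\smallsetminus e$ is the permutation order-isomorphic to the sequence obtained by deleting the entry with value $e$ from $\pi$. The direct sum $\sigma\oplus\tau$ of $\sigma\in S_a,\tau\in S_b$ is $\sigma$ followed by $\tau$ with all values shifted up by $a$. A permutation is decomposable if it is a direct sum of two nonempty permutations, and indecomposable otherwise. Every permutation is uniquely a direct sum of nonempty indecomposable permutations, called its components; $\mathrm{comp}(\pi)$ is their number. $\mathrm{id}_m$ is the identity permutation of length $m$ ($\mathrm{id}_0$ is empty). The reverse-complement of $\pi\in S_n$ is $\pi^{\mathrm{rc}}$ with $\pi^{\mathrm{rc}}_i=n+1-\pi_{n+1-i}$. A permutation $\pi\in S_n$ is almost decomposable if it is indecomposable but $\pi\smallsetminus e$ is decomposable for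 some $e\in\{1,\pi_1,n,\pi_n\}$. The map $f$. Every decomposable $1324$-avoider can be written uniquely as $\pi=\sigma\oplus\mathrm{id}_m\oplus\tau$ with $m\ge0$, $\sigma$ an indecomposable $132$-avoider and $\tau$ an indecomposable $213$-avoider (both nonempty); set $\widetilde f(\pi)=\sigma\oplus\mathrm{id}_{m+1}\oplus\tau$. For a decomposable $1324$-avoider set $f(\pi)=\widetilde f(\pi)$. For an almost decomposable $1324$-avoider $\pi$ define $f(\pi)$ (of length $|\pi|+1$) as follows: (1) if $\pi\smallsetminus\pi_1$ is decomposable, $f(\pi)$ is the permutation with $f(\pi)_1=\pi_1$ and $f(\pi)\smallsetminus\pi_1=\widetilde f(\pi\smallsetminus\pi_1)$; (2) if $\pi\smallsetminus 1$ is decomposable, $f(\pi)=f(\pi^{-1})^{-1}$; (3) otherwise (both $\pi\smallsetminus\pi_1$ and $\pi\smallsetminus1$ indecomposable), $f(\pi)=f(\pi^{\mathrm{rc}})^{\mathrm{rc}}$. (For almost decomposable $1324$-avoiders, cases (1) and (2) cannot occur simultaneously.) A pattern $p$ is $f$-compatible if $f(\pi)$ avoids $p$ for every decomposable or almost decomposable permutation $\pi\in\mathrm{Av}(1324,p)$; otherwise it is $f$-incompatible. *)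

theory Defs
  imports "HOL-Library.Sublist" "HOL-Combinatorics.Multiset_Permutations"
begin

section \<open>Permutations in one-line notation and pattern avoidance\<close>

text \<open>
  A permutation \<open>\<pi>\<close> of length \<open>n\<close> is the list \<open>[\<pi>\<^sub>1, \<dots>, \<pi>\<^sub>n]\<close>.  List positions start
  at 0, but the values are \<open>1, \<dots>, n\<close>; the entry written \<open>\<pi>\<^sub>i\<close> is \<open>\<pi> ! (i - 1)\<close>.
\<close>

definition perms :: "nat \<Rightarrow> nat list set" where
  "perms n = permutations_of_set {1..n}"

definition order_iso :: "nat list \<Rightarrow> nat list \<Rightarrow> bool" where
  "order_iso xs ys \<longleftrightarrow> length xs = length ys \<and>
     (\<forall>i<length xs. \<forall>j<length xs. xs ! i < xs ! j \<longleftrightarrow> ys ! i < ys ! j)"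

definition avoids :: "nat list \<Rightarrow> nat list \<Rightarrow> bool" where
  "avoids \<pi> p \<longleftrightarrow> \<not> (\<exists>s. subseq s \<pi> \<and> order_iso s p)"

definition Av :: "nat list set \<Rightarrow> nat list set" where
  "Av B = {\<pi>. \<pi> \<in> perms (length \<pi>) \<and> (\<forall>p\<in>B. avoids \<pi> p)}"

text \<open>
  The permutation order-isomorphic to a sequence of distinct entries: every entry is
  replaced by its rank (see \<open>std_in_perms\<close> and \<open>order_iso_std\<close>).
\<close>

definition std :: "nat list \<Rightarrow> nat list" where
  "std xs = map (\<lambda>x. card {y \<in> set xs. y \<le> x}) xs"

text \<open>\<open>del \<pi> e\<close> deletes the entry with \<^emph>\<open>value\<close> \<open>e\<close>.\<close>

definition del :: "nat list \<Rightarrow> nat \<Rightarrow> nat list" where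
  "del \<pi> e = std (remove1 e \<pi>)"

definition inv_perm :: "nat list \<Rightarrow> nat list" where
  "inv_perm \<pi> = map (\<lambda>v. Suc (THE i. i < length \<pi> \<and> \<pi> ! i = v)) [1..<Suc (length \<pi>)]"

definition rc :: "nat list \<Rightarrow> nat list" where
  "rc \<pi> = map (\<lambda>v. Suc (length \<pi>) - v) (rev \<pi>)"

definition id_perm :: "nat \<Rightarrow> nat list" where
  "id_perm m = [1..<Suc m]"

definition dsum :: "nat list \<Rightarrow> nat list \<Rightarrow> nat list"  (infixr "\<oplus>" 65) where
  "\<sigma> \<oplus> \<tau> = \<sigma> @ map (\<lambda>v. v + length \<sigma>) \<tau>"

definition decomposable :: "nat list \<Rightarrow> bool" where
  "decomposable \<pi> \<longleftrightarrow> (\<exists>a b. \<exists>\<sigma>\<in>perms a. \<exists>\<tau>\<in>perms b. \<sigma> \<noteq> [] \<and> \<tau> \<noteq> [] \<and> \<pi> = \<sigma> \<oplus> \<tau>)"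

definition components :: "nat list \<Rightarrow> nat list list" where
  "components \<pi> = (THE cs. (\<forall>c\<in>set cs. c \<in> perms (length c) \<and> c \<noteq> [] \<and> \<not> decomposable c)
                        \<and> \<pi> = foldr dsum cs [])"

definition num_components :: "nat list \<Rightarrow> nat" where
  "num_components \<pi> = length (components \<pi>)"

definition almost_decomposable :: "nat list \<Rightarrow> bool" where
  "almost_decomposable \<pi> \<longleftrightarrow> \<pi> \<in> perms (length \<pi>) \<and> \<not> decomposable \<pi> \<and>
     (\<exists>e\<in>{1, hd \<pi>, length \<pi>, last \<pi>}. decomposable (del \<pi> e))"


section \<open>Auxiliary facts for the termination of the recursion defining the map \<open>f\<close>\<close>

lemma perms_iff: "\<pi> \<in> perms n \<longleftrightarrow> distinct \<pi> \<and> set \<pi> = {1..n}"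
  by (auto simp: perms_def permutations_of_set_def)

lemma length_perms: "\<pi> \<in> perms n \<Longrightarrow> length \<pi> = n"
  by (metis card_atLeastAtMost diff_Suc_1 distinct_card perms_iff)

lemma rank_less_iff:
  assumes "finite X" "x \<in> X" "y \<in> X"
  shows "card {z \<in> X. z \<le> x} < card {z \<in> X. z \<le> y} \<longleftrightarrow> x < (y::nat)"
proof
  assume "x < y"
  then have "{z \<in> X. z \<le> x} \<subset> {z \<in> X. z \<le> y}" using assms by force
  then show "card {z \<in> X. z \<le> x} < card {z \<in> X. z \<le> y}"
    by (intro psubset_card_mono) (use assms in auto)
next
  assume *: "card {z \<in> X. z \<le> x} < card {z \<in> X. z \<le> y}"
  show "x < y"
  proof (rule ccontr)
    assume "\<not> x < y"
    then have "{z \<in> X. z \<le> y} \<subseteq> {z \<in> X. z \<le> x}" by auto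
    then have "card {z \<in> X. z \<le> y} \<le> card {z \<in> X. z \<le> x}"
      by (intro card_mono) (use assms in auto)
    with * show False by simp
  qed
qed

lemma order_iso_std: "order_iso (std xs) xs"
  by (auto simp: order_iso_def std_def rank_less_iff)

lemma std_in_perms:
  assumes "distinct xs"
  shows "std xs \<in> perms (length xs)"
proof -
  let ?r = "\<lambda>x. card {y \<in> set xs. y \<le> x}"
  have inj: "inj_on ?r (set xs)"
  proof (rule inj_onI)
    fix x y assume "x \<in> set xs" "y \<in> set xs" "?r x = ?r y"
    then have "\<not> x < y" "\<not> y < x"
      using rank_less_iff[of "set xs" x y] rank_less_iff[of "set xs" y x] by simp_all
    then show "x = y" by simp
  qed
  have "?r ` set xs \<subseteq> {1..length xs}"
  proof
    fix k assume "k \<in> ?r ` set xs"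
    then obtain x where x: "x \<in> set xs" "k = ?r x" by auto
    have "k > 0" unfolding x(2) by (subst card_gt_0_iff) (use x in auto)
    moreover have "k \<le> card (set xs)" unfolding x(2) by (rule card_mono) auto
    ultimately show "k \<in> {1..length xs}" using card_length[of xs] by auto
  qed
  moreover have "card (?r ` set xs) = length xs"
    using inj assms by (simp add: card_image distinct_card)
  ultimately have "?r ` set xs = {1..length xs}"
    by (intro card_subset_eq) auto
  then show ?thesis
    using inj assms by (simp add: perms_iff std_def distinct_map)
qed

lemma subseq_pair_iff:
  "subseq [v, w] xs \<longleftrightarrow> (\<exists>i j. i < j \<and> j < length xs \<and> xs ! i = v \<and> xs ! j = w)"
proof (induction xs)
  case Nil
  then show ?case by simp
next
  case (Cons x xs)
  have *: "subseq [w] xs \<longleftrightarrow> (\<exists>j<length xs. xs ! j = w)"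
    by (simp add: subseq_singleton_left in_set_conv_nth)
  have "(\<exists>i j. i < j \<and> j < length (x # xs) \<and> (x # xs) ! i = v \<and> (x # xs) ! j = w)
     \<longleftrightarrow> (x = v \<and> (\<exists>j<length xs. xs ! j = w))
         \<or> (\<exists>i j. i < j \<and> j < length xs \<and> xs ! i = v \<and> xs ! j = w)" (is "?l \<longleftrightarrow> ?r")
  proof
    assume ?l
    then obtain i j where ij: "i < j" "j < length (x # xs)" "(x # xs) ! i = v" "(x # xs) ! j = w"
      by blast
    then show ?r by (cases i; cases j) auto
  next
    assume ?r
    then show ?l
    proof (elim disjE conjE exE)
      fix j assume "x = v" "j < length xs" "xs ! j = w"
      then show ?l by (intro exI[of _ 0] exI[of _ "Suc j"]) auto
    next
      fix i j assume "i < j" "j < length xs" "xs ! i = v" "xs ! j = w"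
      then show ?l by (intro exI[of _ "Suc i"] exI[of _ "Suc j"]) auto
    qed
  qed
  moreover have "subseq [v, w] (x # xs) \<longleftrightarrow> (x = v \<and> subseq [w] xs) \<or> subseq [v, w] xs"
    by (metis subseq_Cons2_iff subseq_Cons2' subseq_Cons2_neq list_emb_Cons)
  ultimately show ?case using Cons.IH * by simp
qed

definition splits :: "nat list \<Rightarrow> nat set \<Rightarrow> nat set \<Rightarrow> bool" where
  "splits xs V W \<longleftrightarrow> V \<noteq> {} \<and> W \<noteq> {} \<and>
     (\<forall>v\<in>V. \<forall>w\<in>W. v < w \<and> (\<exists>i j. i < j \<and> j < length xs \<and> xs ! i = v \<and> xs ! j = w))"

lemma splits_remove1:
  assumes "distinct xs" "e \<notin> V" "e \<notin> W"
  shows "splits (remove1 e xs) V W \<longleftrightarrow> splits xs V W"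
proof -
  have "subseq [v, w] (remove1 e xs) \<longleftrightarrow> subseq [v, w] xs" if "v \<in> V" "w \<in> W" for v w
  proof -
    have ne: "v \<noteq> e" "w \<noteq> e" using assms that by auto
    have "subseq [v, w] xs \<Longrightarrow> subseq (filter (\<lambda>x. x \<noteq> e) [v, w]) (filter (\<lambda>x. x \<noteq> e) xs)"
      by (rule subseq_filter)
    moreover have "remove1 e xs = filter (\<lambda>x. x \<noteq> e) xs"
      using assms(1) by (simp add: distinct_remove1_removeAll removeAll_filter_not_eq eq_commute)
    moreover have "subseq (filter (\<lambda>x. x \<noteq> e) xs) xs" by (rule subseq_filter_left)
    ultimately show ?thesis using ne by (auto intro: subseq_order.order_trans)
  qed
  then show ?thesis unfolding splits_def subseq_pair_iff[symmetric] by blast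
qed

lemma decomposable_stdD:
  assumes "distinct xs" "decomposable (std xs)"
  shows "\<exists>V W. set xs = V \<union> W \<and> splits xs V W"
proof -
  obtain a b \<sigma> \<tau> where st: "\<sigma> \<in> perms a" "\<tau> \<in> perms b" "\<sigma> \<noteq> []" "\<tau> \<noteq> []"
    "std xs = \<sigma> \<oplus> \<tau>"
    using assms(2) by (auto simp: decomposable_def)
  have la: "length \<sigma> = a" "length \<tau> = b" using st length_perms by auto
  have len: "length xs = a + b"
    using arg_cong[OF st(5), of length] la by (simp add: std_def dsum_def)
  have lo: "std xs ! i \<le> a" if "i < a" for i
  proof -
    have "std xs ! i = \<sigma> ! i" using that la st(5) by (simp add: dsum_def nth_append)
    moreover have "\<sigma> ! i \<in> {1..a}" using that la st(1) nth_mem unfolding perms_iff by metis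
    ultimately show ?thesis by simp
  qed
  have hi: "std xs ! j > a" if "a \<le> j" "j < a + b" for j
  proof -
    have "std xs ! j = \<tau> ! (j - a) + a" using that la st(5) by (simp add: dsum_def nth_append)
    moreover have "\<tau> ! (j - a) \<in> {1..b}"
      using that la st(2) nth_mem[of "j - a" \<tau>] unfolding perms_iff by auto
    ultimately show ?thesis by simp
  qed
  have "set xs = set (take a xs) \<union> set (drop a xs)" by (metis append_take_drop_id set_append)
  moreover have "splits xs (set (take a xs)) (set (drop a xs))"
    unfolding splits_def
  proof (intro conjI ballI)
    show "set (take a xs) \<noteq> {}" "set (drop a xs) \<noteq> {}" using st la len by auto
    fix v w assume "v \<in> set (take a xs)" "w \<in> set (drop a xs)"
    then obtain i k where ik: "i < a" "xs ! i = v" "k < b" "xs ! (a + k) = w"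
      unfolding in_set_conv_nth using len by auto
    define j where "j = a + k"
    have ij: "i < a" "xs ! i = v" "a \<le> j" "j < a + b" "xs ! j = w"
      using ik by (simp_all add: j_def)
    have "std xs ! i < std xs ! j" using lo[of i] hi[of j] ij by linarith
    moreover have "std xs ! i < std xs ! j \<longleftrightarrow> xs ! i < xs ! j"
      using order_iso_std[of xs] ij(1,3,4) len unfolding order_iso_def by (simp add: std_def)
    ultimately have "xs ! i < xs ! j" by simp
    then show "v < w" using ij by simp
    show "\<exists>i j. i < j \<and> j < length xs \<and> xs ! i = v \<and> xs ! j = w"
      using ij len by (intro exI[of _ i] exI[of _ j]) auto
  qed
  ultimately show ?thesis by blast
qed

lemma splits_append:
  fixes xs :: "nat list"
  assumes "distinct xs" "set xs = V \<union> W"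
    "\<forall>v\<in>V. \<forall>w\<in>W. v < w \<and> (\<exists>i j. i < j \<and> j < length xs \<and> xs ! i = v \<and> xs ! j = w)"
  shows "\<exists>ys zs. xs = ys @ zs \<and> set ys = V \<and> set zs = W"
  using assms
proof (induction xs arbitrary: V W)
  case Nil
  then show ?case by auto
next
  case (Cons x xs)
  have less: "v < w" if "v \<in> V" "w \<in> W" for v w using Cons.prems(3) that by simp
  have disj: "V \<inter> W = {}"
  proof (rule equals0I)
    fix x assume "x \<in> V \<inter> W"
    then have "x < x" by (intro less) simp_all
    then show False by simp
  qed
  show ?case
  proof (cases "V = {}")
    case True
    then show ?thesis using Cons.prems by (intro exI[of _ "[]"] exI[of _ "x # xs"]) auto
  next
    case False
    then obtain v where v: "v \<in> V" by auto
    have xV: "x \<in> V"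
    proof (rule ccontr)
      assume "x \<notin> V"
      then have "x \<in> W" using Cons.prems(2) by auto
      then obtain i j where ij: "i < j" "j < length (x # xs)" "(x # xs) ! j = x"
        using Cons.prems(3) v by blast
      moreover have "(x # xs) ! j = (x # xs) ! 0 \<longleftrightarrow> j = 0"
        by (rule nth_eq_iff_index_eq[OF Cons.prems(1) ij(2)]) simp
      ultimately show False by simp
    qed
    have "\<exists>ys zs. xs = ys @ zs \<and> set ys = V - {x} \<and> set zs = W"
    proof (rule Cons.IH)
      show "distinct xs" using Cons.prems by simp
      show "set xs = (V - {x}) \<union> W" using Cons.prems(1,2) xV disj by auto
      show "\<forall>v\<in>V - {x}. \<forall>w\<in>W. v < w \<and> (\<exists>i j. i < j \<and> j < length xs \<and> xs ! i = v \<and> xs ! j = w)"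
      proof (intro ballI conjI)
        fix v w assume vw: "v \<in> V - {x}" "w \<in> W"
        then show "v < w" by (intro less) simp_all
        obtain i j where ij: "i < j" "j < length (x # xs)" "(x # xs) ! i = v" "(x # xs) ! j = w"
          using Cons.prems(3) vw by blast
        then show "\<exists>i j. i < j \<and> j < length xs \<and> xs ! i = v \<and> xs ! j = w"
          using vw by (cases i; cases j) auto
      qed
    qed
    then obtain ys zs where yz: "xs = ys @ zs" "set ys = V - {x}" "set zs = W"
      by (elim exE conjE) (rule that)
    have "x # xs = (x # ys) @ zs" using yz(1) by simp
    moreover have "set (x # ys) = V" using yz(2) xV by (simp add: insert_absorb)
    ultimately show ?thesis using yz(3) by (intro exI conjI)
  qed
qed

lemma decomposable_stdI:
  assumes "distinct xs" "set xs = V \<union> W" "splits xs V W"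
  shows "decomposable (std xs)"
proof -
  obtain ys zs where yz: "xs = ys @ zs" "set ys = V" "set zs = W"
    using splits_append[OF assms(1,2)] assms(3) unfolding splits_def by blast
  have lt: "y < z" if "y \<in> set ys" "z \<in> set zs" for y z
    using assms(3) yz that unfolding splits_def by blast
  have d: "distinct ys" "distinct zs" "set ys \<inter> set zs = {}" using assms(1) yz by auto
  have 1: "{x \<in> set xs. x \<le> y} = {x \<in> set ys. x \<le> y}" if "y \<in> set ys" for y
    using lt[OF that] yz by fastforce
  have 2: "card {x \<in> set xs. x \<le> z} = card {x \<in> set zs. x \<le> z} + length ys"
    if "z \<in> set zs" for z
  proof -
    have "{x \<in> set xs. x \<le> z} = {x \<in> set zs. x \<le> z} \<union> set ys"
      using lt[OF _ that] yz by fastforce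
    moreover have "card \<dots> = card {x \<in> set zs. x \<le> z} + card (set ys)"
      by (rule card_Un_disjoint) (use d in auto)
    ultimately show ?thesis using d by (simp add: distinct_card)
  qed
  have "std xs = std ys \<oplus> std zs"
    using 1 2 by (simp add: std_def dsum_def yz(1))
  moreover have "std ys \<noteq> []" "std zs \<noteq> []"
    using assms(3) yz by (auto simp: std_def splits_def)
  ultimately have "std ys \<noteq> [] \<and> std zs \<noteq> [] \<and> std xs = std ys \<oplus> std zs" by simp
  then have "\<exists>\<tau>\<in>perms (length zs). std ys \<noteq> [] \<and> \<tau> \<noteq> [] \<and> std xs = std ys \<oplus> \<tau>"
    by (rule bexI[OF _ std_in_perms[OF d(2)]])
  then have "\<exists>\<sigma>\<in>perms (length ys). \<exists>\<tau>\<in>perms (length zs). \<sigma> \<noteq> [] \<and> \<tau> \<noteq> [] \<and> std xs = \<sigma> \<oplus> \<tau>"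
    by (rule bexI[OF _ std_in_perms[OF d(1)]])
  then have "\<exists>b. \<exists>\<sigma>\<in>perms (length ys). \<exists>\<tau>\<in>perms b. \<sigma> \<noteq> [] \<and> \<tau> \<noteq> [] \<and> std xs = \<sigma> \<oplus> \<tau>"
    by (rule exI)
  then show ?thesis unfolding decomposable_def by (rule exI)
qed

lemma decomposable_del_iff:
  assumes "\<pi> \<in> perms n"
  shows "decomposable (del \<pi> e) \<longleftrightarrow> (\<exists>V W. {1..n} - {e} = V \<union> W \<and> splits \<pi> V W)"
proof -
  have d: "distinct \<pi>" "set (remove1 e \<pi>) = {1..n} - {e}" "distinct (remove1 e \<pi>)"
    using assms by (auto simp: perms_iff)
  have "decomposable (del \<pi> e)
      \<longleftrightarrow> (\<exists>V W. {1..n} - {e} = V \<union> W \<and> splits (remove1 e \<pi>) V W)"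
    unfolding del_def using decomposable_stdD[OF d(3)] decomposable_stdI[OF d(3)] d(2) by metis
  also have "\<dots> \<longleftrightarrow> (\<exists>V W. {1..n} - {e} = V \<union> W \<and> splits \<pi> V W)"
    using splits_remove1[OF d(1)] by (metis Diff_iff Un_iff singletonI)
  finally show ?thesis .
qed

lemma length_inv_perm [simp]: "length (inv_perm \<pi>) = length \<pi>"
  by (simp add: inv_perm_def del: upt_Suc)

lemma length_rc [simp]: "length (rc \<pi>) = length \<pi>"
  by (simp add: rc_def)

lemma inv_perm_nth:
  assumes "\<pi> \<in> perms n" "i < n"
  shows "inv_perm \<pi> ! (\<pi> ! i - 1) = Suc i"
proof -
  have len: "length \<pi> = n" using assms length_perms by auto
  have "\<pi> ! i \<in> {1..n}" using assms len nth_mem unfolding perms_iff by metis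
  then have "inv_perm \<pi> ! (\<pi> ! i - 1) = Suc (THE k. k < length \<pi> \<and> \<pi> ! k = \<pi> ! i)"
    using len by (auto simp: inv_perm_def simp del: upt_Suc)
  also have "(THE k. k < length \<pi> \<and> \<pi> ! k = \<pi> ! i) = i"
    using assms len by (intro the_equality) (auto simp: perms_iff nth_eq_iff_index_eq)
  finally show ?thesis .
qed

lemma perms_nth_surj:
  assumes "\<pi> \<in> perms n" "v \<in> {1..n}"
  shows "\<exists>i<n. \<pi> ! i = v"
  using assms length_perms[OF assms(1)] unfolding perms_iff by (metis in_set_conv_nth)

lemma inv_perm_in_perms:
  assumes "\<pi> \<in> perms n"
  shows "inv_perm \<pi> \<in> perms n"
proof -
  have len: "length \<pi> = n" using assms length_perms by auto
  have "{1..n} \<subseteq> set (inv_perm \<pi>)"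
  proof
    fix k assume k: "k \<in> {1..n}"
    then have "\<pi> ! (k - 1) \<in> {1..n}"
      using assms len nth_mem[of "k - 1" \<pi>] unfolding perms_iff by auto
    moreover have "k - 1 < n" "Suc (k - 1) = k" using k by auto
    then have "inv_perm \<pi> ! (\<pi> ! (k - 1) - 1) = k"
      using inv_perm_nth[OF assms, of "k - 1"] by simp
    ultimately show "k \<in> set (inv_perm \<pi>)"
      unfolding in_set_conv_nth using len by (intro exI[of _ "\<pi> ! (k - 1) - 1"]) auto
  qed
  moreover have "card (set (inv_perm \<pi>)) \<le> n" using card_length[of "inv_perm \<pi>"] len by simp
  ultimately have "set (inv_perm \<pi>) = {1..n}"
    by (metis List.finite_set card_atLeastAtMost card_seteq diff_Suc_1)
  then show ?thesis
    using len by (simp add: perms_iff card_distinct)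
qed

lemma decomposable_del_inv_perm:
  assumes "\<pi> \<in> perms n" "decomposable (del \<pi> 1)"
  shows "decomposable (del (inv_perm \<pi>) (hd (inv_perm \<pi>)))"
proof -
  let ?q = "inv_perm \<pi>"
  have len: "length \<pi> = n" using assms length_perms by auto
  have q: "?q \<in> perms n" by (rule inv_perm_in_perms[OF assms(1)])
  obtain V W where VW: "{1..n} - {1} = V \<union> W" "splits \<pi> V W"
    using assms(2) unfolding decomposable_del_iff[OF assms(1)] by blast
  have n: "n > 0" using VW unfolding splits_def by auto
  define I where "I = {i. i < n \<and> \<pi> ! i \<in> V}"
  define J where "J = {i. i < n \<and> \<pi> ! i \<in> W}"
  have surj: "\<exists>i<n. \<pi> ! i = v" if "v \<in> V \<union> W" for v
    using perms_nth_surj[OF assms(1), of v] that VW(1) by blast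
  have inj: "i = j" if "i < n" "j < n" "\<pi> ! i = \<pi> ! j" for i j
    using that assms(1) len by (simp add: perms_iff nth_eq_iff_index_eq)
  obtain i0 where i0: "i0 < n" "\<pi> ! i0 = 1"
    using perms_nth_surj[OF assms(1), of 1] n by auto
  have "hd ?q = ?q ! 0" using n len by (intro hd_conv_nth) (metis length_inv_perm less_nat_zero_code list.size(3))
  also have "\<dots> = Suc i0" using inv_perm_nth[OF assms(1) i0(1)] i0(2) by simp
  finally have hd: "hd ?q = Suc i0" .
  have val: "\<pi> ! i \<in> {1..n}" if "i < n" for i
    using that assms(1) len nth_mem unfolding perms_iff by metis
  have eq: "{1..n} - {hd ?q} = Suc ` I \<union> Suc ` J"
  proof (intro equalityI subsetI)
    fix k assume k: "k \<in> {1..n} - {hd ?q}"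
    then have kk: "k - 1 < n" "Suc (k - 1) = k" "k - 1 \<noteq> i0" using hd by auto
    then have "\<pi> ! (k - 1) \<noteq> 1" using inj[of "k - 1" i0] i0 by auto
    then have "\<pi> ! (k - 1) \<in> V \<union> W" using val[OF kk(1)] VW(1) by blast
    then show "k \<in> Suc ` I \<union> Suc ` J"
      unfolding I_def J_def image_Un[symmetric] using kk by (intro image_eqI[of _ _ "k - 1"]) auto
  next
    fix k assume "k \<in> Suc ` I \<union> Suc ` J"
    then obtain i where i: "k = Suc i" "i < n" "\<pi> ! i \<in> V \<union> W" unfolding I_def J_def by auto
    then have "\<pi> ! i \<noteq> 1" using VW(1) by blast
    then show "k \<in> {1..n} - {hd ?q}" using i hd i0 by auto
  qed
  have "splits ?q (Suc ` I) (Suc ` J)"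
    unfolding splits_def
  proof (intro conjI ballI)
    show "Suc ` I \<noteq> {}" "Suc ` J \<noteq> {}"
      using VW(2) surj unfolding splits_def I_def J_def by blast+
    fix v w assume "v \<in> Suc ` I" "w \<in> Suc ` J"
    then obtain i j where ij: "v = Suc i" "w = Suc j" "i < n" "j < n" "\<pi> ! i \<in> V" "\<pi> ! j \<in> W"
      unfolding I_def J_def by auto
    from VW(2) ij(5,6) have lt: "\<pi> ! i < \<pi> ! j" unfolding splits_def by blast
    from VW(2) ij(5,6) obtain i' j' where
      ij': "i' < j'" "j' < length \<pi>" "\<pi> ! i' = \<pi> ! i" "\<pi> ! j' = \<pi> ! j"
      unfolding splits_def by metis
    have "i' = i" "j' = j" using inj[of i' i] inj[of j' j] ij' ij len by auto
    then show "v < w" using ij ij' by simp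
    show "\<exists>i j. i < j \<and> j < length ?q \<and> ?q ! i = v \<and> ?q ! j = w"
      using inv_perm_nth[OF assms(1) ij(3)] inv_perm_nth[OF assms(1) ij(4)]
        val[OF ij(3)] val[OF ij(4)] lt ij len
      by (intro exI[of _ "\<pi> ! i - 1"] exI[of _ "\<pi> ! j - 1"]) auto
  qed
  then show ?thesis unfolding decomposable_del_iff[OF q] using eq by blast
qed

lemma rc_in_perms:
  assumes "\<pi> \<in> perms n"
  shows "rc \<pi> \<in> perms n"
proof -
  have len: "length \<pi> = n" using assms length_perms by auto
  have "(\<lambda>v. Suc n - v) ` {1..n} = {1..n}"
  proof (intro equalityI subsetI)
    fix x assume "x \<in> {1..n}"
    then show "x \<in> (\<lambda>v. Suc n - v) ` {1..n}" by (intro image_eqI[of _ _ "Suc n - x"]) auto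
  qed auto
  moreover have "inj_on (\<lambda>v. Suc n - v) {1..n}" by (auto simp: inj_on_def)
  ultimately show ?thesis using assms len by (simp add: perms_iff rc_def distinct_map)
qed

lemma decomposable_del_rc:
  assumes "\<pi> \<in> perms n" "decomposable (del \<pi> e)" "e \<in> {1..n}"
  shows "decomposable (del (rc \<pi>) (Suc n - e))"
proof -
  let ?c = "\<lambda>v. Suc n - v"
  have len: "length \<pi> = n" using assms length_perms by auto
  obtain V W where VW: "{1..n} - {e} = V \<union> W" "splits \<pi> V W"
    using assms(2) unfolding decomposable_del_iff[OF assms(1)] by blast
  have sub: "V \<subseteq> {1..n} - {e}" "W \<subseteq> {1..n} - {e}" using VW(1) by auto
  have eq: "{1..n} - {?c e} = ?c ` W \<union> ?c ` V"
  proof (intro equalityI subsetI)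
    fix x assume x: "x \<in> {1..n} - {?c e}"
    then have "?c x \<in> V \<union> W" unfolding VW(1)[symmetric] using assms(3) by auto
    moreover have "x = ?c (?c x)" using x by auto
    ultimately show "x \<in> ?c ` W \<union> ?c ` V" by blast
  next
    fix x assume "x \<in> ?c ` W \<union> ?c ` V"
    then obtain y where y: "x = ?c y" "y \<in> {1..n} - {e}" using sub by blast
    then show "x \<in> {1..n} - {?c e}" using assms(3) by auto
  qed
  have "splits (rc \<pi>) (?c ` W) (?c ` V)"
    unfolding splits_def
  proof (intro conjI ballI)
    show "?c ` W \<noteq> {}" "?c ` V \<noteq> {}" using VW(2) unfolding splits_def by auto
    fix x y assume "x \<in> ?c ` W" "y \<in> ?c ` V"
    then obtain v w where vw: "x = ?c w" "y = ?c v" "v \<in> V" "w \<in> W" by auto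
    have "v < w" using VW(2) vw unfolding splits_def by blast
    then show "x < y" using vw sub by auto
    obtain i j where ij: "i < j" "j < length \<pi>" "\<pi> ! i = v" "\<pi> ! j = w"
      using VW(2) vw unfolding splits_def by blast
    show "\<exists>i j. i < j \<and> j < length (rc \<pi>) \<and> rc \<pi> ! i = x \<and> rc \<pi> ! j = y"
      by (intro exI[of _ "n - Suc j"] exI[of _ "n - Suc i"])
        (use ij len vw in \<open>auto simp: rc_def rev_nth\<close>)
  qed
  then show ?thesis unfolding decomposable_del_iff[OF rc_in_perms[OF assms(1)]] using eq by blast
qed


section \<open>The map \<open>f\<close> and compatibility of patterns\<close>

definition f_tilde :: "nat list \<Rightarrow> nat list" where
  "f_tilde \<pi> = (THE \<rho>. \<exists>\<sigma> m \<tau>.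
      \<sigma> \<in> Av {[1, 3, 2]} \<and> \<sigma> \<noteq> [] \<and> \<not> decomposable \<sigma> \<and>
      \<tau> \<in> Av {[2, 1, 3]} \<and> \<tau> \<noteq> [] \<and> \<not> decomposable \<tau> \<and>
      \<pi> = \<sigma> \<oplus> id_perm m \<oplus> \<tau> \<and> \<rho> = \<sigma> \<oplus> id_perm (m + 1) \<oplus> \<tau>)"

text \<open>
  Only the values at decomposable or almost decomposable 1324-avoiders are meaningful.
  The recursion stops: if deleting the value 1 from \<open>\<pi>\<close> leaves a decomposable permutation, so
  does deleting the first entry of \<open>inv_perm \<pi>\<close>, and in the last branch one of the two holds
  for \<open>rc \<pi>\<close>.
\<close>

function f_map :: "nat list \<Rightarrow> nat list" where
  "f_map \<pi> =
    (if decomposable \<pi> then f_tilde \<pi>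
     else if \<not> almost_decomposable \<pi> then undefined
     else if decomposable (del \<pi> (hd \<pi>)) then
       (THE \<rho>. \<rho> \<in> perms (Suc (length \<pi>)) \<and> hd \<rho> = hd \<pi> \<and>
               del \<rho> (hd \<pi>) = f_tilde (del \<pi> (hd \<pi>)))
     else if decomposable (del \<pi> 1) then inv_perm (f_map (inv_perm \<pi>))
     else rc (f_map (rc \<pi>)))"
  by pat_completeness auto

termination f_map
proof (relation "measure (\<lambda>\<pi>. if decomposable (del \<pi> (hd \<pi>)) then 0
                              else if decomposable (del \<pi> 1) then 1 else 2)")
  show "wf (measure (\<lambda>\<pi>. if decomposable (del \<pi> (hd \<pi>)) then 0
                         else if decomposable (del \<pi> 1) then 1 else (2::nat)))" by simp
next
  fix \<pi> :: "nat list"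
  assume "\<not> \<not> almost_decomposable \<pi>" "\<not> decomposable (del \<pi> (hd \<pi>))" "decomposable (del \<pi> 1)"
  then show "(inv_perm \<pi>, \<pi>) \<in> measure (\<lambda>\<pi>. if decomposable (del \<pi> (hd \<pi>)) then 0
                              else if decomposable (del \<pi> 1) then 1 else 2)"
    using decomposable_del_inv_perm[of \<pi> "length \<pi>"] by (simp add: almost_decomposable_def)
next
  fix \<pi> :: "nat list"
  assume a: "\<not> \<not> almost_decomposable \<pi>" "\<not> decomposable (del \<pi> (hd \<pi>))"
    "\<not> decomposable (del \<pi> 1)"
  let ?n = "length \<pi>"
  have p: "\<pi> \<in> perms ?n" using a by (simp add: almost_decomposable_def)
  have e: "decomposable (del \<pi> ?n) \<or> decomposable (del \<pi> (last \<pi>))"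
    using a by (auto simp: almost_decomposable_def)
  have ne: "\<pi> \<noteq> []"
    using e by (auto simp: decomposable_def del_def std_def dsum_def)
  have l: "last \<pi> \<in> {1..?n}" "?n \<in> {1..?n}"
    using p ne last_in_set[OF ne] unfolding perms_iff by (auto simp: Suc_le_eq)
  have "hd (rc \<pi>) = Suc ?n - last \<pi>"
    using ne by (simp add: rc_def hd_map hd_rev)
  then have "decomposable (del (rc \<pi>) 1) \<or> decomposable (del (rc \<pi>) (hd (rc \<pi>)))"
    using e decomposable_del_rc[OF p _ l(1)] decomposable_del_rc[OF p _ l(2)] by auto
  then show "(rc \<pi>, \<pi>) \<in> measure (\<lambda>\<pi>. if decomposable (del \<pi> (hd \<pi>)) then 0
                              else if decomposable (del \<pi> 1) then 1 else 2)"
    using a by auto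
qed

declare f_map.simps [simp del]

definition f_compatible :: "nat list \<Rightarrow> bool" where
  "f_compatible p \<longleftrightarrow>
     (\<forall>\<pi> \<in> Av {[1, 3, 2, 4], p}. decomposable \<pi> \<or> almost_decomposable \<pi> \<longrightarrow> avoids (f_map \<pi>) p)"

end

(*
  If an occurrence of p in sigma + id_(m+1) + tau is new, it must use all middle entries and meet
  both sigma and tau, since otherwise a middle gap can be closed or a middle entry can be replaced
  by an entry of sigma or tau; hence comp(p) >= 3. If f inserts into pi minus its first entry v,
  indecomposability forces v above sigma and the middle, so the values are those of
  v (sigma + id_(m+1) + tau), and the insertion makes v change places with one entry x of tau. A
  new occurrence that avoids x again uses the whole middle and meets sigma, which gives (a) or (b).
  One that uses x gives (d) if it lies within v tau, and otherwise (a) or (c) or (b), according to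
  whether v lies below all of its tau-part. The remaining cases of f follow by symmetry.
*)
theory Submission
  imports Defs
begin

section \<open>Order isomorphism and containment\<close>

text \<open>The entry x is recognised by its value alone: it is \<open>v - 1\<close> before the
  insertion and \<open>v + 1\<close> after it, while every other entry of tau stays on its side of
  v. So the case split is whether the occurrence uses \<open>v + 1\<close>, and away from that value
  lowering the entries of tau by one never crosses v.

  The extra requirement in (c) comes from the order in which the cases of f are tried. The
  reverse-complement is used only when deleting the first entry and deleting 1 both leave
  indecomposable permutations, and this prevents the entry v of the transformed permutation from
  being its largest one. Then the enlarged permutation has an entry \<open>v + 2\<close> in tau. If
  an occurrence has only two components and ends with its maximum, x is its sole entry from tau, and
  \<open>v + 2\<close> can stand in for x; the resulting occurrence avoids x, so (a) or (b) holds
  instead.\<close>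

lemma order_iso_map:
  assumes "strict_mono_on (set xs) g"
  shows "order_iso xs (map g xs)"
  unfolding order_iso_def
  using strict_mono_on_less[OF assms] by simp

text \<open>On distinct entries an order isomorphism is a relabelling of values, so transporting a
  property along it only requires the property to survive one monotone map.\<close>

lemma order_isoE:
  assumes "distinct xs" "order_iso xs ys"
  obtains g where "strict_mono_on (set xs) g" "ys = map g xs"
proof
  let ?g = "\<lambda>x. ys ! (THE i. i < length xs \<and> xs ! i = x)"
  have the: "(THE i. i < length xs \<and> xs ! i = xs ! k) = k" if "k < length xs" for k
    using assms(1) that by (intro the_equality) (auto simp: nth_eq_iff_index_eq)
  show "ys = map ?g xs"
    using assms(2) the by (intro nth_equalityI) (auto simp: order_iso_def)
  show "strict_mono_on (set xs) ?g"
  proof (rule strict_mono_onI)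
    fix r s assume "r \<in> set xs" "s \<in> set xs" "r < s"
    then obtain i j where "i < length xs" "j < length xs" "xs ! i = r" "xs ! j = s"
      by (auto simp: in_set_conv_nth)
    then show "?g r < ?g s"
      using assms(2) the[of i] the[of j] \<open>r < s\<close> by (auto simp: order_iso_def)
  qed
qed

lemma order_iso_sym: "order_iso xs ys \<Longrightarrow> order_iso ys xs"
  by (auto simp: order_iso_def)

lemma order_iso_trans: "order_iso xs ys \<Longrightarrow> order_iso ys zs \<Longrightarrow> order_iso xs zs"
  by (auto simp: order_iso_def)

lemma order_iso_distinct:
  assumes "order_iso xs ys" "distinct xs"
  shows "distinct ys"
proof -
  obtain g where g: "strict_mono_on (set xs) g" "ys = map g xs"
    using order_isoE[OF assms(2,1)] .
  then show ?thesis using assms(2) strict_mono_on_imp_inj_on[OF g(1)] by (simp add: distinct_map)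
qed

lemma subseq_set: "subseq s xs \<Longrightarrow> set s \<subseteq> set xs"
  by (metis set_nths_subset subseq_conv_nths)

lemma avoids_order_iso:
  assumes "order_iso xs ys" "distinct xs" "avoids ys p"
  shows "avoids xs p"
  unfolding avoids_def
proof
  assume "\<exists>s. subseq s xs \<and> order_iso s p"
  then obtain s where s: "subseq s xs" "order_iso s p" by blast
  obtain g where g: "strict_mono_on (set xs) g" "ys = map g xs"
    using order_isoE[OF assms(2,1)] .
  have "strict_mono_on (set s) g"
    using g(1) subseq_set[OF s(1)] by (rule monotone_on_subset)
  then have "order_iso (map g s) p"
    using order_iso_map order_iso_sym order_iso_trans s(2) by blast
  moreover have "subseq (map g s) ys" unfolding g(2) using s(1) by (rule subseq_map)
  ultimately show False using assms(3) unfolding avoids_def by blast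
qed

lemma avoids_subseq: "avoids ys p \<Longrightarrow> subseq xs ys \<Longrightarrow> avoids xs p"
  unfolding avoids_def by (meson subseq_order.order_trans)

lemma avoids_map:
  assumes "avoids (map g xs) p" "strict_mono_on (set xs) g" "distinct xs"
  shows "avoids xs p"
  using avoids_order_iso[OF order_iso_map] assms by blast

text \<open>The common form of the exchange arguments: monotonicity of \<open>g\<close> preserves
  the pattern, and the subsequence condition says that the relabelled entries stand in the right
  places.\<close>

lemma containedI:
  assumes "subseq (map g s) xs" "strict_mono_on (set s) g" "order_iso s p"
  shows "\<not> avoids xs p"
  using assms order_iso_map order_iso_sym order_iso_trans unfolding avoids_def by blast


section \<open>Cuts and components\<close>

text \<open>Unlike components, cuts make sense for arbitrary sequences and are invariant under order
  isomorphism. The full length counts as a cut, so that the number of cuts of a permutation is the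
  number of its components.\<close>

definition cuts :: "nat list \<Rightarrow> nat set" where
  "cuts xs = {i \<in> {1..length xs}. \<forall>x\<in>set (take i xs). \<forall>y\<in>set (drop i xs). x < y}"

definition ncuts :: "nat list \<Rightarrow> nat" where
  "ncuts xs = card (cuts xs)"

lemma finite_cuts [simp]: "finite (cuts xs)"
  by (simp add: cuts_def)

lemma length_in_cuts: "xs \<noteq> [] \<Longrightarrow> length xs \<in> cuts xs"
  by (auto simp: cuts_def Suc_le_eq)

lemma append_in_cuts:
  "us \<noteq> [] \<Longrightarrow> (\<And>x y. x \<in> set us \<Longrightarrow> y \<in> set vs \<Longrightarrow> x < y) \<Longrightarrow> length us \<in> cuts (us @ vs)"
  by (auto simp: cuts_def Suc_le_eq)

lemma cuts_map:
  assumes "strict_mono_on (set xs) g"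
  shows "cuts (map g xs) = cuts xs"
proof -
  have "(\<forall>x\<in>set (take i xs). \<forall>y\<in>set (drop i xs). g x < g y)
      \<longleftrightarrow> (\<forall>x\<in>set (take i xs). \<forall>y\<in>set (drop i xs). x < y)" for i
    by (intro ball_cong refl strict_mono_on_less[OF assms]) (auto dest: in_set_takeD in_set_dropD)
  then show ?thesis by (simp add: cuts_def take_map drop_map)
qed

lemma cuts_order_iso: "order_iso xs ys \<Longrightarrow> distinct xs \<Longrightarrow> cuts ys = cuts xs"
  by (metis cuts_map order_isoE)

section \<open>Direct sums and their cuts\<close>

lemma perms_not_Nil: "p \<in> perms n \<Longrightarrow> p \<noteq> [] \<longleftrightarrow> n > 0"
  using length_perms by fastforce

lemma perms_length: "p \<in> perms n \<Longrightarrow> p \<in> perms (length p)"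
  using length_perms by fastforce

lemma length_dsum [simp]: "length (xs \<oplus> ys) = length xs + length ys"
  by (simp add: dsum_def)

lemma dsum_assoc: "(xs \<oplus> ys) \<oplus> zs = xs \<oplus> ys \<oplus> zs"
  by (simp add: dsum_def)

lemma dsum_Nil [simp]: "xs \<oplus> [] = xs" "[] \<oplus> xs = xs"
  by (simp_all add: dsum_def)

lemma dsum_in_perms:
  assumes "\<sigma> \<in> perms a" "\<tau> \<in> perms b"
  shows "\<sigma> \<oplus> \<tau> \<in> perms (a + b)"
proof -
  have "(\<lambda>v. v + a) ` {1..b} = {a+1..a+b}"
    unfolding image_add_atLeastAtMost' by (simp add: add.commute)
  moreover have "{1..a} \<union> {a+1..a+b} = {1..a+b}" by auto
  ultimately show ?thesis
    using assms length_perms[OF assms(1)] by (auto simp: perms_iff dsum_def distinct_map)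
qed

text \<open>The values before the cut are downward closed in \<open>{1..n}\<close> and there are
  \<open>i\<close> of them, so they are \<open>{1..i}\<close>.\<close>

lemma cut_split:
  assumes "p \<in> perms n" "i \<in> cuts p" "i < n"
  obtains \<sigma> \<tau> where "\<sigma> \<in> perms i" "\<tau> \<in> perms (n - i)" "p = \<sigma> \<oplus> \<tau>" "\<sigma> = take i p"
    "\<tau> = map (\<lambda>v. v - i) (drop i p)"
proof -
  have len: "length p = n" using assms length_perms by auto
  have i: "0 < i" using assms(2) by (auto simp: cuts_def)
  have d: "distinct p" and s: "set p = {1..n}" using assms by (auto simp: perms_iff)
  have un: "set (take i p) \<union> set (drop i p) = {1..n}"
    using s by (metis append_take_drop_id set_append)
  have disj: "set (take i p) \<inter> set (drop i p) = {}"
    using d by (simp add: set_take_disj_set_drop_if_distinct)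
  have lt: "x < y" if "x \<in> set (take i p)" "y \<in> set (drop i p)" for x y
    using assms(2) that by (auto simp: cuts_def)
  have c: "card (set (take i p)) = i" using d len assms(3) by (simp add: distinct_card)
  have t: "set (take i p) = {1..i}"
  proof -
    have "x \<le> i" if x: "x \<in> set (take i p)" for x
    proof -
      have "{1..x} \<subseteq> set (take i p)"
      proof
        fix y assume y: "y \<in> {1..x}"
        moreover have "x \<le> n" using x un by auto
        ultimately have "y \<in> set (take i p) \<union> set (drop i p)" unfolding un by auto
        then show "y \<in> set (take i p)" using lt[OF x, of y] y by auto
      qed
      then have "card {1..x} \<le> card (set (take i p))" by (intro card_mono) auto
      then have "card {1..x} \<le> i" using c by simp
      then show ?thesis by simp
    qed
    then have "set (take i p) \<subseteq> {1..i}" using un by fastforce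
    then show ?thesis by (intro card_subset_eq) (use c in auto)
  qed
  have dr: "set (drop i p) = {i+1..n}"
  proof -
    have "set (drop i p) = (set (take i p) \<union> set (drop i p)) - set (take i p)"
      using disj by blast
    also have "\<dots> = {i+1..n}" unfolding un unfolding t by auto
    finally show ?thesis .
  qed
  have e: "v - i + i = v" if "v \<in> set (drop i p)" for v using that unfolding dr by auto
  show ?thesis
  proof
    show "take i p \<in> perms i" using d t by (simp add: perms_iff)
    have "(\<lambda>v. v - i) ` {i+1..n} = {1..n-i}"
    proof (intro equalityI subsetI)
      fix x assume "x \<in> {1..n-i}"
      then show "x \<in> (\<lambda>v. v - i) ` {i+1..n}" by (intro image_eqI[of _ _ "x+i"]) auto
    qed auto
    moreover have "inj_on (\<lambda>v. v - i) {i+1..n}" by (auto simp: inj_on_def)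
    ultimately show "map (\<lambda>v. v - i) (drop i p) \<in> perms (n - i)"
      using d dr by (simp add: perms_iff distinct_map)
    have "map (\<lambda>v. v - i + i) (drop i p) = drop i p" using e by (intro map_idI) auto
    then show "p = take i p \<oplus> map (\<lambda>v. v - i) (drop i p)"
      using len assms(3) by (simp add: dsum_def o_def)
  qed auto
qed

lemma dsum_cut:
  assumes "\<sigma> \<in> perms a" "\<tau> \<in> perms b" "a > 0"
  shows "a \<in> cuts (\<sigma> \<oplus> \<tau>)"
proof -
  have "length \<sigma> = a" using assms length_perms by auto
  then show ?thesis
    using append_in_cuts[of \<sigma> "map (\<lambda>v. v + length \<sigma>) \<tau>"] assms
    by (fastforce simp: dsum_def perms_iff)
qed

lemma decomposable_iff_cut:
  assumes "p \<in> perms n"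
  shows "decomposable p \<longleftrightarrow> (\<exists>i<n. i \<in> cuts p)"
proof
  assume "decomposable p"
  then obtain a b \<sigma> \<tau> where st: "\<sigma> \<in> perms a" "\<tau> \<in> perms b" "\<sigma> \<noteq> []" "\<tau> \<noteq> []" "p = \<sigma> \<oplus> \<tau>"
    unfolding decomposable_def by blast
  have "a + b = n" using st(5) assms st(1,2) length_perms by (metis length_dsum)
  then show "\<exists>i<n. i \<in> cuts p"
    using dsum_cut[OF st(1,2)] st perms_not_Nil[OF st(1)] perms_not_Nil[OF st(2)]
    by (intro exI[of _ a]) auto
next
  assume "\<exists>i<n. i \<in> cuts p"
  then obtain i where i: "i < n" "i \<in> cuts p" by blast
  obtain \<sigma> \<tau> where st: "\<sigma> \<in> perms i" "\<tau> \<in> perms (n - i)" "p = \<sigma> \<oplus> \<tau>"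
    using cut_split[OF assms i(2,1)] by metis
  have "0 < i" using i(2) by (auto simp: cuts_def)
  then have "\<sigma> \<noteq> []" "\<tau> \<noteq> []" using perms_not_Nil[OF st(1)] perms_not_Nil[OF st(2)] i by auto
  then show "decomposable p" unfolding decomposable_def using st by blast
qed

text \<open>A cut strictly inside \<open>\<sigma>\<close> would decompose it, and beyond the seam
  the entries of \<open>\<sigma>\<close> lie below everything, so only \<open>\<tau>\<close>
  decides.\<close>

lemma cuts_dsum:
  assumes "\<sigma> \<in> perms a" "\<tau> \<in> perms b" "a > 0" "\<not> decomposable \<sigma>"
  shows "cuts (\<sigma> \<oplus> \<tau>) = insert a ((+) a ` cuts \<tau>)"
proof -
  have len: "length \<sigma> = a" "length \<tau> = b" using assms length_perms by auto
  show ?thesis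
  proof (intro equalityI subsetI)
    fix i assume i: "i \<in> cuts (\<sigma> \<oplus> \<tau>)"
    consider "i < a" | "i = a" | "i > a" by linarith
    then show "i \<in> insert a ((+) a ` cuts \<tau>)"
    proof cases
      case 1
      then have "i \<in> cuts \<sigma>" using i len unfolding cuts_def dsum_def by auto
      then show ?thesis using assms(4) 1 decomposable_iff_cut[OF assms(1)] by blast
    next
      case 3
      then have "i - a \<in> cuts \<tau>"
        using i len unfolding cuts_def dsum_def by (auto simp: take_map drop_map ball_Un)
      then show ?thesis using 3 by (intro insertI2 image_eqI[of _ _ "i - a"]) auto
    qed auto
  next
    fix i assume "i \<in> insert a ((+) a ` cuts \<tau>)"
    then consider "i = a" | j where "i = a + j" "j \<in> cuts \<tau>" by blast
    then show "i \<in> cuts (\<sigma> \<oplus> \<tau>)"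
    proof cases
      case 1
      then show ?thesis using dsum_cut assms by auto
    next
      case 2
      have "x \<le> a" if "x \<in> set \<sigma>" for x using that assms(1) by (simp add: perms_iff)
      moreover have "y > 0" if "y \<in> set (drop j \<tau>)" for y
        using that assms(2) in_set_dropD by (fastforce simp: perms_iff)
      ultimately show ?thesis
        using 2 len unfolding cuts_def dsum_def by (fastforce simp: take_map drop_map)
    qed
  qed
qed

section \<open>Existence and uniqueness of the decomposition into components\<close>

definition is_component :: "nat list \<Rightarrow> bool" where
  "is_component c \<longleftrightarrow> c \<in> perms (length c) \<and> c \<noteq> [] \<and> \<not> decomposable c"

lemma foldr_dsum_in_perms:
  "(\<forall>c\<in>set cs. is_component c) \<Longrightarrow> foldr dsum cs [] \<in> perms (length (foldr dsum cs []))"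
proof (induction cs)
  case Nil
  then show ?case by (simp add: perms_iff)
next
  case (Cons c cs)
  then show ?case using dsum_in_perms[of c "length c"] by (simp add: is_component_def)
qed

text \<open>Each component contributes exactly one cut, its right end.\<close>

lemma ncuts_foldr_dsum: "(\<forall>c\<in>set cs. is_component c) \<Longrightarrow> ncuts (foldr dsum cs []) = length cs"
proof (induction cs)
  case Nil
  then show ?case by (simp add: ncuts_def cuts_def)
next
  case (Cons c cs)
  let ?r = "foldr dsum cs []"
  have "cuts (c \<oplus> ?r) = insert (length c) ((+) (length c) ` cuts ?r)"
    using Cons.prems foldr_dsum_in_perms[of cs] by (intro cuts_dsum) (auto simp: is_component_def)
  moreover have "length c \<notin> (+) (length c) ` cuts ?r" by (auto simp: cuts_def)
  moreover have "card ((+) (length c) ` cuts ?r) = ncuts ?r"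
    unfolding ncuts_def by (intro card_image) auto
  ultimately show ?case using Cons by (simp add: ncuts_def)
qed

text \<open>The length of the first component is the least cut, so it depends on the permutation
  only. Applying this bound in both directions makes the first components agree, and the shift can
  be cancelled from the rest.\<close>

lemma components_unique:
  "(\<forall>c\<in>set cs. is_component c) \<Longrightarrow> (\<forall>d\<in>set ds. is_component d) \<Longrightarrow>
    foldr dsum cs [] = foldr dsum ds [] \<Longrightarrow> cs = ds"
proof (induction cs arbitrary: ds)
  case Nil
  then show ?case using ncuts_foldr_dsum[of ds] ncuts_foldr_dsum[of "[]"] by simp
next
  case (Cons c cs)
  have "length ds = Suc (length cs)"
    using Cons.prems ncuts_foldr_dsum[of ds] ncuts_foldr_dsum[of "c # cs"] by simp
  then obtain d ds' where ds: "ds = d # ds'" by (cases ds) auto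
  let ?x = "foldr dsum cs []" and ?y = "foldr dsum ds' []"
  have x: "?x \<in> perms (length ?x)" "?y \<in> perms (length ?y)"
    using Cons.prems ds foldr_dsum_in_perms by auto
  have eq: "c \<oplus> ?x = d \<oplus> ?y" using Cons.prems ds by simp
  have least: "length c \<le> length d"
    if "is_component c" "is_component d" "X \<in> perms (length X)" "Y \<in> perms (length Y)"
      "c \<oplus> X = d \<oplus> Y" for c d X Y
  proof -
    have "length d \<in> cuts (c \<oplus> X)"
      using that dsum_cut[of d "length d" Y] by (auto simp: is_component_def)
    also have "\<dots> = insert (length c) ((+) (length c) ` cuts X)"
      using that by (intro cuts_dsum) (auto simp: is_component_def)
    finally show ?thesis by auto
  qed
  have len: "length c = length d"
    using least[of c d ?x ?y] least[of d c ?y ?x] eq x Cons.prems ds by fastforce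
  then have "c = d" "map (\<lambda>v. v + length d) ?x = map (\<lambda>v. v + length d) ?y"
    using eq by (auto simp: dsum_def)
  moreover have "inj (\<lambda>v. v + length d)" by (simp add: inj_def)
  ultimately have "c = d" "?x = ?y" using inj_map_eq_map by blast+
  then show ?case using Cons.IH[of ds'] Cons.prems ds by simp
qed

text \<open>Split at the least cut: a proper cut of that prefix would be a smaller cut of
  \<open>p\<close>, so the prefix is a component.\<close>

lemma components_exist:
  "p \<in> perms n \<Longrightarrow> \<exists>cs. (\<forall>c\<in>set cs. is_component c) \<and> p = foldr dsum cs []"
proof (induction n arbitrary: p rule: less_induct)
  case (less n)
  show ?case
  proof (cases "p = []")
    case True
    then show ?thesis by (intro exI[of _ "[]"]) simp
  next
    case False
    then have ne: "n \<in> cuts p" using length_in_cuts length_perms[OF less.prems] by auto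
    define i where "i = (LEAST i. i \<in> cuts p)"
    have i: "i \<in> cuts p" unfolding i_def using ne by (rule LeastI)
    have min: "i \<le> j" if "j \<in> cuts p" for j unfolding i_def using that by (rule Least_le)
    have i0: "0 < i" using i by (auto simp: cuts_def)
    show ?thesis
    proof (cases "i = n")
      case True
      then have "\<not> decomposable p" using min decomposable_iff_cut[OF less.prems] by fastforce
      then have "is_component p" using False perms_length[OF less.prems] by (simp add: is_component_def)
      then show ?thesis by (intro exI[of _ "[p]"]) simp
    next
      case neq: False
      then have "i < n" using min[OF ne] by simp
      then obtain \<sigma> \<tau> where st: "\<sigma> \<in> perms i" "\<tau> \<in> perms (n - i)" "p = \<sigma> \<oplus> \<tau>" "\<sigma> = take i p"
        using cut_split[OF less.prems i] by metis
      have "j \<in> cuts p" if j: "j \<in> cuts \<sigma>" "j < i" for j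
      proof -
        have "x < y" if "x \<in> set (take j p)" "y \<in> set (drop j p)" for x y
        proof -
          have "take j \<sigma> = take j p" "drop j p = drop j \<sigma> @ drop i p"
            using st(4) j(2) drop_take[of j i p]
            by (auto simp: min_def) (metis append_take_drop_id drop_append drop_drop drop_take
              le_add_diff_inverse2 less_imp_le_nat)
          moreover have "x \<in> set (take i p)"
            using that(1) j(2) set_take_subset_set_take[of j i p] by auto
          ultimately show ?thesis using that j(1) i unfolding cuts_def by auto
        qed
        then show ?thesis using j \<open>i < n\<close> length_perms[OF less.prems] by (auto simp: cuts_def)
      qed
      then have "\<not> decomposable \<sigma>" using decomposable_iff_cut[OF st(1)] min by fastforce
      then have "is_component \<sigma>"
        using st(1) i0 perms_not_Nil[OF st(1)] perms_length by (auto simp: is_component_def)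
      moreover obtain cs where "\<forall>c\<in>set cs. is_component c" "\<tau> = foldr dsum cs []"
        using less.IH[OF _ st(2)] i0 \<open>i < n\<close> by auto
      ultimately show ?thesis using st(3) by (intro exI[of _ "\<sigma> # cs"]) simp
    qed
  qed
qed

lemma components_foldr:
  assumes "\<forall>c\<in>set cs. is_component c"
  shows "components (foldr dsum cs []) = cs"
  unfolding components_def is_component_def[symmetric]
  using assms components_unique by (intro the_equality) blast+

lemma num_components_eq: "p \<in> perms n \<Longrightarrow> num_components p = ncuts p"
  using components_exist components_foldr ncuts_foldr_dsum unfolding num_components_def by metis

text \<open>With two components there is only one cut before the end, hence any such cut exhibits
  the first component. This recovers (c) from its formulation with cuts.\<close>

lemma hd_components:
  assumes "p \<in> perms n" "ncuts p = 2" "i \<in> cuts p" "i < n"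
  shows "hd (components p) = take i p"
proof -
  obtain cs where cs: "\<forall>c\<in>set cs. is_component c" "p = foldr dsum cs []"
    using components_exist[OF assms(1)] by blast
  have "length cs = 2" using ncuts_foldr_dsum[OF cs(1)] cs(2) assms(2) by simp
  then obtain c d where cd: "cs = [c, d]" by (auto simp: numeral_2_eq_2 length_Suc_conv)
  have p: "p = c \<oplus> d" using cs(2) cd by simp
  have "cuts p = insert (length c) ((+) (length c) ` cuts (d \<oplus> []))"
    unfolding p using cs cd by (subst cuts_dsum) (auto simp: is_component_def)
  also have "cuts (d \<oplus> []) = {length d}"
    using cs cd by (subst cuts_dsum[of _ "length d" _ 0]) (auto simp: is_component_def perms_iff cuts_def)
  finally have "i = length c \<or> i = length c + length d" using assms(3) by auto
  moreover have "n = length c + length d" using p length_perms[OF assms(1)] by simp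
  ultimately have "i = length c" using assms(4) by simp
  then show ?thesis using cd cs components_foldr[OF cs(1)] p by (simp add: dsum_def)
qed


section \<open>Values of the map \<open>f\<close>\<close>

lemma order_iso_132: "order_iso s [1, 3, 2] \<longleftrightarrow> (\<exists>x y z. s = [x, y, z] \<and> x < z \<and> z < y)"
  by (auto simp: order_iso_def length_Suc_conv numeral_eq_Suc less_Suc_eq)

lemma order_iso_213: "order_iso s [2, 1, 3] \<longleftrightarrow> (\<exists>x y z. s = [x, y, z] \<and> y < x \<and> x < z)"
  by (auto simp: order_iso_def length_Suc_conv numeral_eq_Suc less_Suc_eq)

lemma order_iso_1324:
  "order_iso s [1, 3, 2, 4] \<longleftrightarrow> (\<exists>w x y z. s = [w, x, y, z] \<and> w < y \<and> y < x \<and> x < z)"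
  by (auto simp: order_iso_def length_Suc_conv numeral_eq_Suc less_Suc_eq)

lemma id_perm_Suc: "id_perm (Suc m) = [1] \<oplus> id_perm m"
  unfolding id_perm_def dsum_def by (simp add: map_Suc_upt upt_conv_Cons del: upt_Suc)

lemma length_id_perm [simp]: "length (id_perm m) = m"
  by (simp add: id_perm_def)

lemma id_perm_in_perms: "id_perm m \<in> perms m"
  by (auto simp: id_perm_def perms_iff)

lemma foldr_dsum_append:
  "foldr dsum (xs @ ys) [] = foldr dsum xs [] \<oplus> foldr dsum ys []"
  by (induction xs) (simp_all add: dsum_assoc)

lemma foldr_dsum_replicate: "foldr dsum (replicate m [1]) [] = id_perm m"
  by (induction m) (simp_all add: id_perm_Suc, simp add: id_perm_def)

lemma is_component_singleton: "is_component [1]"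
proof -
  have "[1] \<in> perms 1" by (simp add: perms_iff)
  then show ?thesis
    using decomposable_iff_cut[of "[1]" 1] by (auto simp: is_component_def cuts_def)
qed

text \<open>\<open>f_tilde\<close> is a definite description, so the triple has to be shown unique.
  Writing the identity as \<open>m\<close> components \<open>[1]\<close> reduces this to
  \<open>components_unique\<close>.\<close>

lemma f_tilde_eq:
  assumes "is_component \<sigma>" "avoids \<sigma> [1, 3, 2]" "is_component \<tau>" "avoids \<tau> [2, 1, 3]"
  shows "f_tilde (\<sigma> \<oplus> id_perm m \<oplus> \<tau>) = \<sigma> \<oplus> id_perm (m + 1) \<oplus> \<tau>"
  unfolding f_tilde_def
proof (rule the_equality)
  show "\<exists>\<sigma>' m' \<tau>'. \<sigma>' \<in> Av {[1, 3, 2]} \<and> \<sigma>' \<noteq> [] \<and> \<not> decomposable \<sigma>' \<and>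
      \<tau>' \<in> Av {[2, 1, 3]} \<and> \<tau>' \<noteq> [] \<and> \<not> decomposable \<tau>' \<and>
      \<sigma> \<oplus> id_perm m \<oplus> \<tau> = \<sigma>' \<oplus> id_perm m' \<oplus> \<tau>' \<and>
      \<sigma> \<oplus> id_perm (m + 1) \<oplus> \<tau> = \<sigma>' \<oplus> id_perm (m' + 1) \<oplus> \<tau>'"
    using assms unfolding Av_def is_component_def by blast
  have form: "\<sigma> \<oplus> id_perm m \<oplus> \<tau> = foldr dsum (\<sigma> # replicate m [1] @ [\<tau>]) []" for \<sigma> m \<tau>
    by (simp add: foldr_dsum_append foldr_dsum_replicate del: foldr_append foldr_replicate One_nat_def)
  fix \<rho>
  assume "\<exists>\<sigma>' m' \<tau>'. \<sigma>' \<in> Av {[1, 3, 2]} \<and> \<sigma>' \<noteq> [] \<and> \<not> decomposable \<sigma>' \<and>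
      \<tau>' \<in> Av {[2, 1, 3]} \<and> \<tau>' \<noteq> [] \<and> \<not> decomposable \<tau>' \<and>
      \<sigma> \<oplus> id_perm m \<oplus> \<tau> = \<sigma>' \<oplus> id_perm m' \<oplus> \<tau>' \<and>
      \<rho> = \<sigma>' \<oplus> id_perm (m' + 1) \<oplus> \<tau>'"
  then obtain \<sigma>' m' \<tau>' where 1: "is_component \<sigma>'" "is_component \<tau>'"
    "\<sigma> \<oplus> id_perm m \<oplus> \<tau> = \<sigma>' \<oplus> id_perm m' \<oplus> \<tau>'"
    and \<rho>: "\<rho> = \<sigma>' \<oplus> id_perm (m' + 1) \<oplus> \<tau>'"
    unfolding Av_def is_component_def by blast
  have eq: "\<sigma> # replicate m [1] @ [\<tau>] = \<sigma>' # replicate m' [1] @ [\<tau>']"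
    using 1 assms is_component_singleton unfolding form by (intro components_unique) auto
  then have "\<sigma> = \<sigma>'" "\<tau> = \<tau>'" "m = m'" using arg_cong[OF eq, of length] by auto
  then show "\<rho> = \<sigma> \<oplus> id_perm (m + 1) \<oplus> \<tau>" using \<rho> by simp
qed

text \<open>Let \<open>M\<close> be the sum of all inner components. An inversion in
  \<open>M\<close> extends to 1324 by an entry of \<open>\<sigma>\<close> and one of
  \<open>\<tau>\<close>; a 132 in \<open>\<sigma>\<close> extends by an entry of
  \<open>\<tau>\<close>, and a 213 in \<open>\<tau>\<close> by an entry of
  \<open>\<sigma>\<close>.\<close>

lemma decomposable_1324_avoider:
  assumes "\<pi> \<in> perms N" "decomposable \<pi>" "avoids \<pi> [1, 3, 2, 4]"
  obtains \<sigma> m \<tau> where "is_component \<sigma>" "avoids \<sigma> [1, 3, 2]" "is_component \<tau>"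
    "avoids \<tau> [2, 1, 3]" "\<pi> = \<sigma> \<oplus> id_perm m \<oplus> \<tau>"
proof -
  obtain cs where cs: "\<forall>c\<in>set cs. is_component c" "\<pi> = foldr dsum cs []"
    using components_exist[OF assms(1)] by blast
  obtain i where i: "i < N" "i \<in> cuts \<pi>" using assms decomposable_iff_cut by blast
  have len\<pi>: "length \<pi> = N" using assms length_perms by auto
  then have "\<pi> \<noteq> []" using i by auto
  then have "{i, N} \<subseteq> cuts \<pi>" using i length_in_cuts len\<pi> by auto
  then have "card {i, N} \<le> ncuts \<pi>" unfolding ncuts_def by (intro card_mono) auto
  then have "length cs \<ge> 2" using ncuts_foldr_dsum[OF cs(1)] cs(2) i by auto
  then obtain \<sigma> cs' where "cs = \<sigma> # cs'" "cs' \<noteq> []"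
    by (cases cs) (auto simp: Suc_le_eq)
  then obtain mid \<tau> where csd: "cs = \<sigma> # mid @ [\<tau>]" by (metis append_butlast_last_id)
  define M where "M = foldr dsum mid []"
  define m where "m = length M"
  have comp: "is_component \<sigma>" "is_component \<tau>" using cs csd by auto
  have M: "M \<in> perms m" unfolding M_def m_def using cs csd by (intro foldr_dsum_in_perms) auto
  have "\<pi> = \<sigma> \<oplus> M \<oplus> \<tau>" unfolding cs(2) csd M_def by (simp add: foldr_dsum_append del: foldr_append)
  then have \<pi>: "\<pi> = \<sigma> @ map (\<lambda>v. v + length \<sigma>) M @ map (\<lambda>v. v + (m + length \<sigma>)) \<tau>"
    by (simp add: dsum_def m_def add.assoc)
  have ne: "\<sigma> \<noteq> []" "\<tau> \<noteq> []" using comp by (auto simp: is_component_def)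
  have \<sigma>le: "x \<le> length \<sigma>" if "x \<in> set \<sigma>" for x
    using that comp by (simp add: is_component_def perms_iff)
  have \<tau>ge: "x > 0" if "x \<in> set \<tau>" for x
    using that comp by (auto simp: is_component_def perms_iff)
  have Mle: "x > 0" "x \<le> m" if "x \<in> set M" for x
    using that M by (auto simp: perms_iff)
  have no: "\<not> (subseq [w, x, y, z] \<pi> \<and> w < y \<and> y < x \<and> x < z)" for w x y z
    using assms(3) order_iso_1324 unfolding avoids_def by blast
  have "sorted M"
    unfolding sorted_iff_nth_mono_less
  proof (intro allI impI, rule ccontr)
    fix i j assume ij: "i < j" "j < length M" "\<not> M ! i \<le> M ! j"
    have "subseq [M ! i, M ! j] M" using ij unfolding subseq_pair_iff by blast
    then have "subseq (map (\<lambda>v. v + length \<sigma>) [M ! i, M ! j]) (map (\<lambda>v. v + length \<sigma>) M)"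
      by (rule subseq_map)
    moreover have "subseq [hd \<sigma>] \<sigma>" "subseq [hd \<tau> + (m + length \<sigma>)] (map (\<lambda>v. v + (m + length \<sigma>)) \<tau>)"
      using ne by (auto simp: subseq_singleton_left)
    ultimately have "subseq ([hd \<sigma>] @ map (\<lambda>v. v + length \<sigma>) [M ! i, M ! j] @ [hd \<tau> + (m + length \<sigma>)]) \<pi>"
      unfolding \<pi> by (intro list_emb_append_mono)
    moreover have "hd \<sigma> < M ! j + length \<sigma>" "M ! i < hd \<tau> + m"
      using \<sigma>le[of "hd \<sigma>"] \<tau>ge[of "hd \<tau>"] Mle[of "M ! i"] Mle[of "M ! j"] ne ij by fastforce+
    ultimately show False
      using no[of "hd \<sigma>" "M ! i + length \<sigma>" "M ! j + length \<sigma>" "hd \<tau> + (m + length \<sigma>)"] ij by simp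
  qed
  then have "M = id_perm m"
    using M id_perm_in_perms[of m] unfolding id_perm_def perms_iff
    by (intro sorted_distinct_set_unique) (auto simp del: upt_Suc)
  moreover have "avoids \<sigma> [1, 3, 2]"
    unfolding avoids_def order_iso_132
  proof
    assume "\<exists>s. subseq s \<sigma> \<and> (\<exists>x y z. s = [x, y, z] \<and> x < z \<and> z < y)"
    then obtain x y z where xyz: "subseq [x, y, z] \<sigma>" "x < z" "z < y" by blast
    have "subseq [hd \<tau> + (m + length \<sigma>)] (map (\<lambda>v. v + (m + length \<sigma>)) \<tau>)"
      using ne by (auto simp: subseq_singleton_left)
    then have "subseq ([x, y, z] @ [] @ [hd \<tau> + (m + length \<sigma>)]) \<pi>"
      unfolding \<pi> using xyz(1) by (intro list_emb_append_mono) auto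
    moreover have "y < hd \<tau> + (m + length \<sigma>)"
      using \<sigma>le[of y] subseq_set[OF xyz(1)] \<tau>ge[of "hd \<tau>"] ne by simp
    ultimately show False using no[of x y z "hd \<tau> + (m + length \<sigma>)"] xyz by simp
  qed
  moreover have "avoids \<tau> [2, 1, 3]"
    unfolding avoids_def order_iso_213
  proof
    assume "\<exists>s. subseq s \<tau> \<and> (\<exists>x y z. s = [x, y, z] \<and> y < x \<and> x < z)"
    then obtain x y z where xyz: "subseq [x, y, z] \<tau>" "y < x" "x < z" by blast
    let ?g = "\<lambda>v. v + (m + length \<sigma>)"
    have "subseq (map ?g [x, y, z]) (map ?g \<tau>)" using xyz(1) by (rule subseq_map)
    moreover have "subseq [hd \<sigma>] \<sigma>" using ne by (auto simp: subseq_singleton_left)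
    ultimately have "subseq ([hd \<sigma>] @ [] @ map ?g [x, y, z]) \<pi>"
      unfolding \<pi> by (intro list_emb_append_mono) auto
    moreover have "hd \<sigma> < y + (m + length \<sigma>)"
      using \<sigma>le[of "hd \<sigma>"] subseq_set[OF xyz(1)] \<tau>ge[of y] ne by simp
    ultimately show False
      using no[of "hd \<sigma>" "?g x" "?g y" "?g z"] xyz by simp
  qed
  ultimately show ?thesis using that comp \<open>\<pi> = \<sigma> \<oplus> M \<oplus> \<tau>\<close> by blast
qed

section \<open>Rebuilding a permutation from its first entry and the rest\<close>

definition bump :: "nat \<Rightarrow> nat \<Rightarrow> nat" where
  "bump v y = (if y < v then y else Suc y)"

lemma bump_strict_mono: "strict_mono_on A (bump v)"
  by (rule strict_mono_onI) (auto simp: bump_def)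

lemma std_perm:
  assumes "\<pi> \<in> perms n"
  shows "std \<pi> = \<pi>"
proof -
  have "{y \<in> {1..n}. y \<le> x} = {1..x}" if "x \<in> {1..n}" for x using that by auto
  then show ?thesis using assms unfolding std_def perms_iff by (intro map_idI) auto
qed

lemma std_map:
  assumes "strict_mono_on (set xs) g"
  shows "std (map g xs) = std xs"
proof -
  have inj: "inj_on g (set xs)" using assms by (rule strict_mono_on_imp_inj_on)
  have "{y \<in> g ` set xs. y \<le> g x} = g ` {y \<in> set xs. y \<le> x}" if "x \<in> set xs" for x
    using that strict_mono_on_less_eq[OF assms] by auto
  then have "card {y \<in> g ` set xs. y \<le> g x} = card {y \<in> set xs. y \<le> x}" if "x \<in> set xs" for x
    using that by (simp add: card_image inj_on_subset[OF inj])
  then show ?thesis by (simp add: std_def)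
qed

text \<open>Standardizing lowers exactly the entries above the missing value \<open>v\<close> by
  one, and \<open>bump v\<close> raises them again.\<close>

lemma bump_std:
  assumes "distinct w" "set w = {1..N} - {v}" "v \<in> {1..N}"
  shows "map (bump v) (std w) = w"
  unfolding std_def map_map
proof (rule map_idI)
  fix x assume x: "x \<in> set w"
  have "{y \<in> set w. y \<le> x} = {1..x} - {v}" using x unfolding assms(2) by auto
  moreover have "card ({1..x} - {v}) = (if v \<le> x then x - 1 else x)"
    using assms(3) by (cases "v \<le> x") (auto simp: card_Diff_singleton)
  ultimately have "card {y \<in> set w. y \<le> x} = (if v \<le> x then x - 1 else x)" by simp
  then show "(bump v \<circ> (\<lambda>x. card {y \<in> set w. y \<le> x})) x = x"
    using conjunct1[OF x[unfolded assms(2) Diff_iff]] conjunct2[OF x[unfolded assms(2) Diff_iff]]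
    by (auto simp: bump_def)
qed

lemma perm_eq_Cons_bump:
  assumes "\<rho> \<in> perms N" "\<rho> \<noteq> []"
  shows "\<rho> = hd \<rho> # map (bump (hd \<rho>)) (del \<rho> (hd \<rho>))"
proof -
  obtain v w where vw: "\<rho> = v # w" using assms(2) by (cases \<rho>) auto
  then have "distinct w" "set w = {1..N} - {v}" "v \<in> {1..N}" using assms(1) by (auto simp: perms_iff)
  then have "map (bump v) (std w) = w" by (rule bump_std)
  then show ?thesis using vw by (simp add: del_def)
qed

lemma Cons_bump_in_perms:
  assumes "Z \<in> perms N" "v \<in> {1..Suc N}"
  shows "v # map (bump v) Z \<in> perms (Suc N)"
proof -
  have "bump v ` {1..N} = {1..Suc N} - {v}"
  proof (intro equalityI subsetI)
    fix x assume "x \<in> {1..Suc N} - {v}"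
    then show "x \<in> bump v ` {1..N}"
      using assms(2) by (intro image_eqI[of _ _ "if x < v then x else x - 1"]) (auto simp: bump_def)
  qed (auto simp: bump_def)
  then show ?thesis
    using assms strict_mono_on_imp_inj_on[OF bump_strict_mono] by (auto simp: perms_iff distinct_map)
qed

text \<open>The definite description in \<open>f_map\<close> has only one solution because a
  permutation is determined by its first entry together with what its deletion leaves.\<close>

lemma f_map_del_hd:
  assumes "\<pi> \<in> perms N" "\<not> decomposable \<pi>" "decomposable (del \<pi> (hd \<pi>))" "\<pi> \<noteq> []"
    "f_tilde (del \<pi> (hd \<pi>)) \<in> perms N"
  shows "f_map \<pi> = hd \<pi> # map (bump (hd \<pi>)) (f_tilde (del \<pi> (hd \<pi>)))"
proof -
  let ?v = "hd \<pi>" and ?Z = "f_tilde (del \<pi> (hd \<pi>))"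
  have "almost_decomposable \<pi>"
    using assms perms_length unfolding almost_decomposable_def by blast
  then have "f_map \<pi> = (THE \<rho>. \<rho> \<in> perms (Suc (length \<pi>)) \<and> hd \<rho> = ?v \<and> del \<rho> ?v = ?Z)"
    using assms by (subst f_map.simps) simp
  also have "\<dots> = ?v # map (bump ?v) ?Z"
  proof (rule the_equality, intro conjI)
    have "?v \<in> {1..N}" using assms(1) hd_in_set[OF assms(4)] by (simp add: perms_iff)
    then show "?v # map (bump ?v) ?Z \<in> perms (Suc (length \<pi>))"
      using Cons_bump_in_perms[OF assms(5)] length_perms[OF assms(1)] by auto
    have "del (x # xs) x = std xs" for x xs by (simp add: del_def)
    then show "del (?v # map (bump ?v) ?Z) ?v = ?Z"
      using std_map[OF bump_strict_mono] std_perm[OF assms(5)] by simp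
  next
    fix \<rho> assume *: "\<rho> \<in> perms (Suc (length \<pi>)) \<and> hd \<rho> = ?v \<and> del \<rho> ?v = ?Z"
    then have "\<rho> \<noteq> []" using perms_not_Nil by blast
    then show "\<rho> = ?v # map (bump ?v) ?Z" using perm_eq_Cons_bump * by metis
  qed simp
  finally show ?thesis .
qed

lemma del_in_perms:
  assumes "\<pi> \<in> perms N" "\<pi> \<noteq> []"
  shows "del \<pi> (hd \<pi>) \<in> perms (N - 1)" "order_iso (del \<pi> (hd \<pi>)) (tl \<pi>)"
proof -
  have "del \<pi> (hd \<pi>) = std (tl \<pi>)" using assms(2) by (cases \<pi>) (auto simp: del_def)
  moreover have "length (tl \<pi>) = N - 1" "distinct (tl \<pi>)"
    using length_perms[OF assms(1)] assms(1) by (auto simp: perms_iff distinct_tl)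
  ultimately show "del \<pi> (hd \<pi>) \<in> perms (N - 1)" "order_iso (del \<pi> (hd \<pi>)) (tl \<pi>)"
    using std_in_perms order_iso_std by metis+
qed

lemma perms_distinct: "\<pi> \<in> perms n \<Longrightarrow> distinct \<pi>"
  by (simp add: perms_iff)

lemma f_map_del_hd_form:
  assumes "\<pi> \<in> perms N" "avoids \<pi> [1, 3, 2, 4]" "\<not> decomposable \<pi>" "decomposable (del \<pi> (hd \<pi>))"
  obtains \<sigma> m \<tau> v where "is_component \<sigma>" "is_component \<tau>" "avoids \<tau> [2, 1, 3]"
    "\<pi> = v # map (bump v) (\<sigma> \<oplus> id_perm m \<oplus> \<tau>)"
    "f_map \<pi> = v # map (bump v) (\<sigma> \<oplus> id_perm (m + 1) \<oplus> \<tau>)"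
    "length \<sigma> + m + 2 \<le> v" "v \<le> N" "N = length \<sigma> + m + length \<tau> + 1"
proof -
  have ne: "\<pi> \<noteq> []"
    using assms(4) by (auto simp: decomposable_def del_def std_def dsum_def)
  let ?v = "hd \<pi>" and ?d = "del \<pi> (hd \<pi>)"
  have "subseq (tl \<pi>) \<pi>" by (metis subseq_order.order_refl list.sel(2) list.collapse subseq_Cons')
  then have "avoids ?d [1, 3, 2, 4]"
    using avoids_order_iso[OF del_in_perms(2)[OF assms(1) ne]] perms_distinct[OF del_in_perms(1)[OF assms(1) ne]]
      avoids_subseq[OF assms(2)] by blast
  then obtain \<sigma> m \<tau> where st: "is_component \<sigma>" "avoids \<sigma> [1, 3, 2]" "is_component \<tau>"
    "avoids \<tau> [2, 1, 3]" "?d = \<sigma> \<oplus> id_perm m \<oplus> \<tau>"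
    using decomposable_1324_avoider[OF del_in_perms(1)[OF assms(1) ne] assms(4)] by metis
  have lenN: "length \<pi> = N" using assms length_perms by auto
  have "length ?d = N - 1" using del_in_perms[OF assms(1) ne] length_perms by blast
  moreover have "N > 0" using ne lenN by auto
  ultimately have N: "N = length \<sigma> + m + length \<tau> + 1" using st(5) by simp
  have tilde: "f_tilde ?d = \<sigma> \<oplus> id_perm (m + 1) \<oplus> \<tau>" unfolding st(5) by (rule f_tilde_eq) fact+
  have p: "\<sigma> \<in> perms (length \<sigma>)" "\<tau> \<in> perms (length \<tau>)" using st by (auto simp: is_component_def)
  have "f_tilde ?d \<in> perms (length \<sigma> + ((m + 1) + length \<tau>))"
    unfolding tilde by (intro dsum_in_perms p id_perm_in_perms)
  moreover have "length \<sigma> + ((m + 1) + length \<tau>) = N" using N by simp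
  ultimately have "f_tilde ?d \<in> perms N" by simp
  then have f: "f_map \<pi> = ?v # map (bump ?v) (\<sigma> \<oplus> id_perm (m + 1) \<oplus> \<tau>)"
    using f_map_del_hd[OF assms(1,3,4) ne] tilde by simp
  have \<pi>: "\<pi> = ?v # map (bump ?v) (\<sigma> \<oplus> id_perm m \<oplus> \<tau>)"
    using perm_eq_Cons_bump[OF assms(1) ne] st(5) by simp
  have vN: "?v \<le> N" using assms(1) hd_in_set[OF ne] by (simp add: perms_iff)
  \<comment> \<open>For a smaller first entry the values of the prefix consisting of it,
    \<open>\<sigma>\<close> and the identity would all lie below those of \<open>\<tau>\<close>, and
    \<open>\<pi>\<close> would be decomposable. The value \<open>length \<sigma> + m + 1\<close> is
    excluded too, so the first entry also exceeds the additional middle entry.\<close>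
  have "length \<sigma> + m + 2 \<le> ?v"
  proof (rule ccontr)
    assume small: "\<not> length \<sigma> + m + 2 \<le> ?v"
    let ?us = "?v # map (bump ?v) (\<sigma> \<oplus> id_perm m)"
    let ?vs = "map (bump ?v) (map (\<lambda>v. v + (length \<sigma> + m)) \<tau>)"
    have "\<pi> = ?us @ ?vs"
      by (subst \<pi>, subst dsum_assoc[symmetric], subst dsum_def) simp
    moreover have "length ?us \<in> cuts (?us @ ?vs)"
    proof (rule append_in_cuts)
      fix x y assume xy: "x \<in> set ?us" "y \<in> set ?vs"
      have "\<sigma> \<oplus> id_perm m \<in> perms (length \<sigma> + m)" by (intro dsum_in_perms p id_perm_in_perms)
      then have "x \<le> length \<sigma> + m + 1" using xy(1) small by (auto simp: perms_iff bump_def)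
      moreover have "y \<ge> length \<sigma> + m + 2" using xy(2) small p(2) by (auto simp: perms_iff bump_def)
      ultimately show "x < y" by simp
    qed simp
    moreover have "length ?us < N" using N st(3) by (simp add: is_component_def)
    ultimately show False using assms(3) decomposable_iff_cut[OF assms(1)] by auto
  qed
  then show ?thesis using that st \<pi> f vN N by blast
qed


section \<open>Occurrences in the enlarged permutation\<close>

lemma two_cuts:
  assumes "s1 \<noteq> []" "s2 \<noteq> []" "\<And>x y. x \<in> set s1 \<Longrightarrow> y \<in> set s2 \<Longrightarrow> x < y"
  shows "ncuts (s1 @ s2) \<ge> 2"
proof -
  have "{length s1, length (s1 @ s2)} \<subseteq> cuts (s1 @ s2)"
    using append_in_cuts[of s1 s2] length_in_cuts[of "s1 @ s2"] assms by auto
  then have "card {length s1, length (s1 @ s2)} \<le> ncuts (s1 @ s2)"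
    unfolding ncuts_def by (intro card_mono) auto
  then show ?thesis using assms by auto
qed

lemma three_cuts:
  assumes "s1 \<noteq> []" "s2 \<noteq> []" "s3 \<noteq> []"
    "\<And>x y. x \<in> set s1 \<Longrightarrow> y \<in> set (s2 @ s3) \<Longrightarrow> x < y"
    "\<And>x y. x \<in> set s2 \<Longrightarrow> y \<in> set s3 \<Longrightarrow> x < y"
  shows "ncuts (s1 @ s2 @ s3) \<ge> 3"
proof -
  let ?s = "s1 @ s2 @ s3"
  let ?C = "{length s1, length (s1 @ s2), length ?s}"
  have "length (s1 @ s2) \<in> cuts ((s1 @ s2) @ s3)" using assms by (intro append_in_cuts) auto
  then have "?C \<subseteq> cuts ?s"
    using append_in_cuts[of s1 "s2 @ s3"] length_in_cuts[of ?s] assms by auto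
  then have "card ?C \<le> ncuts ?s"
    unfolding ncuts_def by (intro card_mono) auto
  then show ?thesis using assms by auto
qed

text \<open>A cut before the end would need a later entry above the first one.\<close>

lemma cuts_max_hd:
  assumes "s \<noteq> []" "\<And>y. y \<in> set s \<Longrightarrow> y \<le> hd s"
  shows "cuts s = {length s}"
proof -
  have "i = length s" if i: "i \<in> cuts s" for i
  proof (rule ccontr)
    assume "i \<noteq> length s"
    then have i': "0 < i" "i < length s" using i by (auto simp: cuts_def)
    then have ne: "take i s \<noteq> []" "drop i s \<noteq> []" by auto
    have "hd s \<in> set (take i s)" using hd_in_set[OF ne(1)] i'(1) by simp
    moreover have "hd (drop i s) \<in> set (drop i s)" using ne(2) by simp
    ultimately have "hd s < hd (drop i s)" using i unfolding cuts_def by blast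
    moreover have "hd (drop i s) \<le> hd s" using assms(2) in_set_dropD[OF hd_in_set[OF ne(2)]] by blast
    ultimately show False by simp
  qed
  then show ?thesis using length_in_cuts[OF assms(1)] by blast
qed

text \<open>Otherwise the occurrence can be moved into the shorter sequence: close the gap left by an
  unused middle entry, respectively replace the middle entry \<open>a+1\<close> by an entry of \<open>\<sigma>\<close>. The map
  \<open>h\<close> says how the entries above the middle have to move.\<close>

lemma occurrence_uses_middle:
  fixes h :: "nat \<Rightarrow> nat"
  assumes sub: "subseq s1 \<sigma>" "subseq s2 [a+1..<a+m+2]" "subseq (map h s3) T"
    and \<sigma>: "\<sigma> \<noteq> []" "\<And>x. x \<in> set \<sigma> \<Longrightarrow> x \<le> a"
    and h: "strict_mono_on (set ws \<union> set s3) h" "map h ws = ws"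
      "\<And>y. y \<in> set ws \<union> set s3 \<Longrightarrow> a + m + 1 < y \<and> a + m < h y"
    and av: "avoids (ws @ \<sigma> @ [a+1..<a+m+1] @ T) p"
    and iso: "order_iso (ws @ s1 @ s2 @ s3) p"
  shows "s2 = [a+1..<a+m+2]" "s1 \<noteq> []"
proof -
  have s1: "x \<le> a" if "x \<in> set s1" for x using \<sigma>(2) subseq_set[OF sub(1)] that by blast
  have s2: "a + 1 \<le> x" "x \<le> a + m + 1" if "x \<in> set s2" for x
    using subseq_set[OF sub(2)] that by fastforce+
  have sorted2: "sorted_wrt (<) s2"
    using sub(2) unfolding subseq_conv_nths
    by (auto simp: strict_sorted_iff sorted_nths distinct_nthsI simp del: upt_Suc)
  have no: False if "strict_mono_on (set (ws @ s1 @ s2 @ s3)) g"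
    "subseq (map g (ws @ s1 @ s2 @ s3)) (ws @ \<sigma> @ [a+1..<a+m+1] @ T)" for g
    using containedI[OF that(2,1) iso] av by blast
  have hmono: "h y < h z" if "y \<in> set ws \<union> set s3" "z \<in> set ws \<union> set s3" "y < z" for y z
    using strict_mono_onD[OF h(1) that] .
  have "set [a+1..<a+m+2] \<subseteq> set s2"
  proof (rule ccontr)
    assume "\<not> set [a+1..<a+m+2] \<subseteq> set s2"
    then obtain e where e: "a + 1 \<le> e" "e \<le> a + m + 1" "e \<notin> set s2" by fastforce
    define g where "g y = (if y < e then y else if y \<le> a + m + 1 then y - 1 else h y)" for y
    have g1: "g y = y" if "y \<in> set s1" for y using s1[OF that] e by (simp add: g_def)
    have g3: "g y = h y" if "y \<in> set ws \<union> set s3" for y using h(3)[OF that] e by (auto simp: g_def)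
    have g2: "g y < g z" if "y \<in> set s2" "z \<in> set s2" "y < z" for y z
    proof -
      have "y \<noteq> e" "z \<noteq> e" using that e(3) by blast+
      then show ?thesis using that(3) s2[OF that(1)] s2[OF that(2)] by (auto simp: g_def)
    qed
    have g2': "a + 1 \<le> g y" "g y \<le> a + m" if "y \<in> set s2" for y
    proof -
      have "y \<noteq> e" using that e(3) by blast
      then show "a + 1 \<le> g y" "g y \<le> a + m" using s2[OF that] e by (auto simp: g_def)
    qed
    have "strict_mono_on (set (ws @ s1 @ s2 @ s3)) g"
    proof (rule strict_mono_onI)
      fix y z assume yz: "y \<in> set (ws @ s1 @ s2 @ s3)" "z \<in> set (ws @ s1 @ s2 @ s3)" "y < z"
      then consider "y \<in> set s1" | "y \<in> set s2" | "y \<in> set ws \<union> set s3" by auto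
      then show "g y < g z"
      proof cases
        case 1
        then show ?thesis using yz g1 g2'[of z] g3[of z] s1[of y] h(3)[of z] by fastforce
      next
        case 2
        consider "z \<in> set s1" | "z \<in> set s2" | "z \<in> set ws \<union> set s3" using yz by auto
        then show ?thesis
        proof cases
          case 1
          then show ?thesis using s1[of z] s2[of y] 2 yz by simp
        next
          case 3
          then show ?thesis using g2'[OF 2] g3[OF 3] h(3)[OF 3] by simp
        qed (use g2 2 yz in auto)
      next
        case 3
        then have "z \<in> set ws \<union> set s3" using yz h(3)[OF 3] s1[of z] s2[of z] by fastforce
        then show ?thesis using hmono[OF 3] g3 3 yz by simp
      qed
    qed
    moreover have "subseq (map g s2) [a+1..<a+m+1]"
    proof (rule sorted_subset_imp_subseq)
      show "sorted_wrt (<) (map g s2)"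
        unfolding sorted_wrt_map by (rule sorted_wrt_mono_rel[OF _ sorted2]) (rule g2)
      show "set (map g s2) \<subseteq> set [a+1..<a+m+1]" using g2' by (force simp: less_Suc_eq_le simp del: upt_Suc)
    qed (simp del: upt_Suc)
    then have "subseq (ws @ s1 @ map g s2 @ map h s3) (ws @ \<sigma> @ [a+1..<a+m+1] @ T)"
      using sub by (intro list_emb_append_mono) auto
    moreover have "map g (ws @ s1 @ s2 @ s3) = ws @ s1 @ map g s2 @ map h s3"
    proof -
      have "map g ws = ws" using g3 h(2) map_cong[of ws ws g h] by simp
      moreover have "map g s1 = s1" using g1 by (intro map_idI)
      moreover have "map g s3 = map h s3" using g3 by simp
      ultimately show ?thesis by simp
    qed
    ultimately show False using no by metis
  qed
  then have "length [a+1..<a+m+2] \<le> length s2"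
    using card_mono[of "set s2" "set [a+1..<a+m+2]"] card_length[of s2] distinct_card[of "[a+1..<a+m+2]"]
    by (simp del: upt_Suc)
  then show s2_eq: "s2 = [a+1..<a+m+2]"
    using sub(2) by (metis le_antisym list_emb_length subseq_same_length)
  show "s1 \<noteq> []"
  proof
    assume [simp]: "s1 = []"
    \<comment> \<open>As \<open>s1\<close> is empty, \<open>hd \<sigma>\<close> is free, and it lies
      below and to the left of the middle. It replaces \<open>a + 1\<close>, and the other middle
      entries move down to fill the shorter middle.\<close>
    define g where "g y = (if y \<le> a + 1 then hd \<sigma> else if y \<le> a + m + 1 then y - 1 else h y)" for y
    have hd: "hd \<sigma> \<le> a" using \<sigma> by simp
    have g3: "g y = h y" if "y \<in> set ws \<union> set s3" for y using h(3)[OF that] by (auto simp: g_def)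
    have "strict_mono_on (set (ws @ s1 @ s2 @ s3)) g"
    proof (rule strict_mono_onI)
      fix y z assume yz: "y \<in> set (ws @ s1 @ s2 @ s3)" "z \<in> set (ws @ s1 @ s2 @ s3)" "y < z"
      then consider "y \<in> set s2" | "y \<in> set ws \<union> set s3" by auto
      then show "g y < g z"
      proof cases
        case 1
        consider "z \<in> set s2" | "z \<in> set ws \<union> set s3" using yz by auto
        then show ?thesis
        proof cases
          case 11: 1
          then show ?thesis using s2[OF 1] s2[OF 11] yz hd by (auto simp: g_def)
        next
          case 2
          then show ?thesis using s2[OF 1] g3[OF 2] h(3)[OF 2] hd by (auto simp: g_def)
        qed
      next
        case 2
        then have "z \<in> set ws \<union> set s3" using yz h(3)[OF 2] s2[of z] by fastforce
        then show ?thesis using hmono[OF 2] g3 2 yz by simp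
      qed
    qed
    moreover have "map g s2 = hd \<sigma> # [a+1..<a+m+1]"
    proof -
      have "s2 = (a + 1) # map Suc [a+1..<a+m+1]"
        unfolding s2_eq map_Suc_upt by (subst upt_conv_Cons) auto
      moreover have "map g (map Suc [a+1..<a+m+1]) = [a+1..<a+m+1]"
        unfolding map_map by (intro map_idI) (auto simp: g_def simp del: upt_Suc)
      ultimately show ?thesis by (simp add: g_def del: upt_Suc)
    qed
    moreover have "map g ws = ws" using g3 h(2) map_cong[of ws ws g h] by simp
    moreover have m3: "map g s3 = map h s3" using g3 by simp
    moreover have "subseq [hd \<sigma>] \<sigma>" using \<sigma> by (simp add: subseq_singleton_left)
    then have "subseq (ws @ [hd \<sigma>] @ [a+1..<a+m+1] @ map g s3) (ws @ \<sigma> @ [a+1..<a+m+1] @ T)"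
      unfolding m3 using sub(3) by (intro list_emb_append_mono) auto
    ultimately show False using no[of g] by (simp del: upt_Suc)
  qed
qed

lemma id_perm_shift: "map (\<lambda>v. v + a) (id_perm k) = [a+1..<a+k+1]"
  by (intro nth_equalityI) (simp_all add: id_perm_def del: upt_Suc)

lemma dsum_id_dsum:
  "\<sigma> \<oplus> id_perm k \<oplus> \<tau> =
    \<sigma> @ [length \<sigma> + 1..<length \<sigma> + k + 1] @ map (\<lambda>t. t + (length \<sigma> + k)) \<tau>"
  unfolding dsum_def using id_perm_shift[of "length \<sigma>" k] by (simp add: o_def add.assoc add.left_commute del: upt_Suc)

lemma subseq_mapE:
  assumes "subseq s (map f xs)"
  obtains s0 where "subseq s0 xs" "s = map f s0"
  using assms unfolding subseq_conv_nths nths_map by blast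

lemma f_tilde_new_occurrence:
  assumes "is_component \<sigma>" "is_component \<tau>" "distinct p"
    "\<not> avoids (\<sigma> \<oplus> id_perm (m + 1) \<oplus> \<tau>) p" "avoids (\<sigma> \<oplus> id_perm m \<oplus> \<tau>) p"
  shows "ncuts p \<ge> 3"
proof -
  define a where "a = length \<sigma>"
  define T where "T = map (\<lambda>t. t + (a + m)) \<tau>"
  have \<sigma>: "\<sigma> \<noteq> []" "\<And>x. x \<in> set \<sigma> \<Longrightarrow> x \<le> a"
    using assms(1) by (auto simp: is_component_def perms_iff a_def)
  have \<tau>: "\<tau> \<noteq> []" "\<And>x. x \<in> set \<tau> \<Longrightarrow> 0 < x"
    using assms(2) by (auto simp: is_component_def perms_iff)
  have av: "avoids (\<sigma> @ [a+1..<a+m+1] @ T) p"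
    using assms(5) unfolding dsum_id_dsum T_def a_def .
  obtain s where s: "order_iso s p"
    "subseq s (\<sigma> @ [a+1..<a+m+2] @ map (\<lambda>t. t + (a + m + 1)) \<tau>)"
    using assms(4) unfolding dsum_id_dsum avoids_def a_def by (auto simp: add.assoc simp del: upt_Suc)
  obtain s1 s2 s3 where s123: "s = s1 @ s2 @ s3" "subseq s1 \<sigma>" "subseq s2 [a+1..<a+m+2]"
    "subseq s3 (map (\<lambda>t. t + (a + m + 1)) \<tau>)"
    using s(2) by (metis subseq_appendE)
  obtain s0 where s0: "subseq s0 \<tau>" "s3 = map (\<lambda>t. t + (a + m + 1)) s0"
    using subseq_mapE[OF s123(4)] .
  have 3: "a + m + 1 < y" if "y \<in> set s3" for y using that subseq_set[OF s0(1)] \<tau>(2) s0(2) by auto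
  have "subseq (map (\<lambda>y. y - 1) s3) T"
    using subseq_map[OF s0(1), of "\<lambda>t. t + (a + m)"] unfolding T_def s0(2) by (simp add: o_def)
  \<comment> \<open>\<open>ws\<close> holds what stands in front of \<open>\<sigma>\<close>: nothing
    here, the first entry \<open>v\<close> when \<open>f\<close> prepends one. Removing a middle
    entry lowers everything above it by one, which gives the map on \<open>s3\<close>.\<close>
  note mid = occurrence_uses_middle[OF s123(2,3) this \<sigma>, where ws = "[]" and p = p]
  have "strict_mono_on (set s3) (\<lambda>y. y - 1)"
    by (rule strict_mono_onI) (use 3 in fastforce)
  then have ne: "s2 = [a+1..<a+m+2]" "s1 \<noteq> []"
    using mid av s(1) 3 unfolding s123(1) by force+
  have "s3 \<noteq> []"
  proof
    assume "s3 = []"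
    \<comment> \<open>The mirror image of the exchange with \<open>\<sigma>\<close>: the last middle
      entry \<open>a + m + 1\<close> is replaced by the first entry of the part above the shorter
      middle.\<close>
    define g where "g y = (if y \<le> a + m then y else hd T)" for y
    have T: "a + m < hd T" "hd T \<in> set T" using \<tau> by (auto simp: T_def hd_map)
    have s1: "x \<le> a" if "x \<in> set s1" for x using \<sigma>(2) subseq_set[OF s123(2)] that by blast
    have "strict_mono_on (set s) g"
    proof (rule strict_mono_onI)
      fix y z assume yz: "y \<in> set s" "z \<in> set s" "y < z"
      then have "z \<le> a + m + 1" using s1[of z] ne(1) unfolding s123(1) \<open>s3 = []\<close> by (auto simp del: upt_Suc)
      then show "g y < g z" using yz T(1) by (auto simp: g_def)
    qed
    moreover have "map g s = s1 @ [a+1..<a+m+1] @ [hd T]"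
    proof -
      have "map g s1 = s1" using s1 by (intro map_idI) (fastforce simp: g_def)
      moreover have "[a+1..<a+m+2] = [a+1..<a+m+1] @ [a+m+1]" using upt_Suc_append[of "a+1" "a+m+1"] by simp
      moreover have "map g [a+1..<a+m+1] = [a+1..<a+m+1]"
        by (intro map_idI) (auto simp: g_def simp del: upt_Suc)
      ultimately show ?thesis unfolding s123(1) ne(1) \<open>s3 = []\<close> by (simp add: g_def del: upt_Suc)
    qed
    moreover have "subseq (s1 @ [a+1..<a+m+1] @ [hd T]) (\<sigma> @ [a+1..<a+m+1] @ T)"
      using s123(2) T(2) by (intro list_emb_append_mono) (auto simp: subseq_singleton_left)
    ultimately show False using containedI[OF _ _ s(1)] av by metis
  qed
  have "ncuts s \<ge> 3"
    unfolding s123(1)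
  proof (rule three_cuts)
    show "s2 \<noteq> []" using ne by simp
    fix x y
    show "x < y" if "x \<in> set s1" "y \<in> set (s2 @ s3)"
      using that \<sigma>(2)[of x] subseq_set[OF s123(2)] 3[of y] ne(1) by (fastforce simp del: upt_Suc)
    show "x < y" if "x \<in> set s2" "y \<in> set s3"
      using that 3[of y] ne(1) by (auto simp del: upt_Suc)
  qed fact+
  then show ?thesis
    using cuts_order_iso[OF order_iso_sym[OF s(1)] assms(3)] unfolding ncuts_def by simp
qed


text \<open>The alternatives (a)--(d) of the theorem, phrased for arbitrary sequences so that they are
  invariant under order isomorphism; the flag \<open>c\<close> adds the extra requirement of (c).\<close>

definition has_property :: "bool \<Rightarrow> nat list \<Rightarrow> bool" where
  "has_property c s \<longleftrightarrow> ncuts s \<ge> 3 \<or> ncuts (tl s) > ncuts s \<or>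
     (\<exists>y\<in>set s. y < hd s) \<and> ncuts s = 2 \<and>
       (\<exists>i\<in>cuts s. i < length s \<and> (\<forall>x\<in>set (take i s). x \<le> hd s)) \<and>
       (c \<longrightarrow> (\<exists>y\<in>set s. last s < y)) \<or>
     (\<exists>y\<in>set s. y < hd s) \<and> (\<exists>y\<in>set s. hd s < y) \<and> avoids (tl s) [2, 1, 3]"

text \<open>The alternatives are read off from an occurrence inside the enlarged permutation and
  have to be carried over to the pattern.\<close>

lemma has_property_order_iso:
  assumes "order_iso s p" "distinct s" "s \<noteq> []" "has_property c s"
  shows "has_property c p"
proof -
  obtain g where g: "strict_mono_on (set s) g" "p = map g s" using order_isoE[OF assms(2,1)] .
  have p: "hd p = g (hd s)" "last p = g (last s)" "tl p = map g (tl s)" "set p = g ` set s"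
    "length p = length s" using assms(3) by (auto simp: g(2) hd_map last_map map_tl)
  have less: "g x < g y" if "x \<in> set s" "y \<in> set s" "x < y" for x y
    using strict_mono_onD[OF g(1) that] .
  have le: "g x \<le> g y" if "x \<in> set s" "y \<in> set s" "x \<le> y" for x y
    using less[OF that(1,2)] that(3) by (auto simp: le_less)
  have gtl: "strict_mono_on (set (tl s)) g"
    using g(1) by (rule monotone_on_subset) (auto intro: list.set_sel(2)[OF assms(3)])
  have hl: "hd s \<in> set s" "last s \<in> set s" using assms(3) by auto
  have n: "cuts p = cuts s" "ncuts p = ncuts s" "ncuts (tl p) = ncuts (tl s)"
    using cuts_map[OF g(1)] cuts_map[OF gtl] unfolding ncuts_def p(3) unfolding g(2) by simp_all
  have lo: "\<exists>y\<in>set p. y < hd p" if "\<exists>y\<in>set s. y < hd s" unfolding p(1,2,4) using that less hl by blast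
  have up: "\<exists>y\<in>set p. hd p < y" if "\<exists>y\<in>set s. hd s < y" unfolding p(1,2,4) using that less hl by blast
  have la: "\<exists>y\<in>set p. last p < y" if "\<exists>y\<in>set s. last s < y" unfolding p(1,2,4) using that less hl by blast
  have mx: "\<exists>i\<in>cuts p. i < length p \<and> (\<forall>x\<in>set (take i p). x \<le> hd p)"
    if ex: "\<exists>i\<in>cuts s. i < length s \<and> (\<forall>x\<in>set (take i s). x \<le> hd s)"
  proof -
    obtain i where i: "i \<in> cuts s" "i < length s" "\<And>x. x \<in> set (take i s) \<Longrightarrow> x \<le> hd s"
      using ex by blast
    have "g x \<le> g (hd s)" if "x \<in> set (take i s)" for x
      using that i(3) by (intro le hl in_set_takeD[OF that])
    then show ?thesis using i(1,2) n(1) p(1,5) unfolding g(2) by (auto simp: take_map)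
  qed
  have "avoids (tl p) [2, 1, 3]" if "avoids (tl s) [2, 1, 3]"
    using avoids_order_iso[OF order_iso_sym[OF order_iso_map[OF gtl]] _ that] p(3)
      order_iso_distinct[OF order_iso_map[OF gtl]] assms(2) by (simp add: distinct_tl)
  then show ?thesis
    using assms(4) lo up la mx unfolding has_property_def n by blast
qed

text \<open>Only the part from \<open>\<tau>\<close> is affected by \<open>bump v\<close>. For a
  first entry of at least \<open>length \<sigma> + m + 2\<close> the hypothesis on \<open>v\<close>
  holds both for \<open>k = m\<close> and for \<open>k = m + 1\<close>.\<close>

lemma map_bump_dsum:
  assumes "\<And>x. x \<in> set \<sigma> \<Longrightarrow> x \<le> length \<sigma>" "length \<sigma> + k < v"
  shows "map (bump v) (\<sigma> \<oplus> id_perm k \<oplus> \<tau>) =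
    \<sigma> @ [length \<sigma> + 1..<length \<sigma> + k + 1] @ map (\<lambda>t. bump v (t + (length \<sigma> + k))) \<tau>"
proof -
  have "map (bump v) \<sigma> = \<sigma>" using assms by (intro map_idI) (fastforce simp: bump_def)
  moreover have "map (bump v) [length \<sigma> + 1..<length \<sigma> + k + 1] = [length \<sigma> + 1..<length \<sigma> + k + 1]"
    using assms(2) by (intro map_idI) (auto simp: bump_def simp del: upt_Suc)
  ultimately show ?thesis unfolding dsum_id_dsum by (simp add: o_def del: upt_Suc)
qed

text \<open>Here \<open>f\<close> and \<open>f'\<close> give the values of the entries of
  \<open>\<tau>\<close> before and after the insertion. They differ in their position relative to
  \<open>v\<close> only for the entry with \<open>f' t = v + 1\<close>, where
  \<open>f t = v - 1\<close>. The flag \<open>v < N\<close> says that the value \<open>v + 2\<close>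
  is still available in \<open>\<tau>\<close>.\<close>

lemma has_property_new_occurrence:
  assumes "is_component \<sigma>" "is_component \<tau>" "avoids \<tau> [2, 1, 3]"
    and v: "length \<sigma> + m + 2 \<le> v" "v \<le> N" "N = length \<sigma> + m + length \<tau> + 1"
    and "distinct p" and p: "p \<noteq> []"
    and new: "\<not> avoids (v # map (bump v) (\<sigma> \<oplus> id_perm (m + 1) \<oplus> \<tau>)) p"
    and old: "avoids (v # map (bump v) (\<sigma> \<oplus> id_perm m \<oplus> \<tau>)) p"
  shows "has_property (v < N) p"
proof -
  define a where "a = length \<sigma>"
  define f' where "f' t = bump v (t + (a + m + 1))" for t
  define f where "f t = bump v (t + (a + m))" for t
  have \<sigma>: "\<sigma> \<noteq> []" "\<And>x. x \<in> set \<sigma> \<Longrightarrow> x \<le> a"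
    using assms(1) by (auto simp: is_component_def perms_iff a_def)
  have \<tau>: "\<tau> \<noteq> []" "\<And>x. x \<in> set \<tau> \<Longrightarrow> 0 < x" "set \<tau> = {1..length \<tau>}" "distinct \<tau>"
    using assms(2) by (auto simp: is_component_def perms_iff)
  have va: "a + m + 2 \<le> v" using v(1) by (simp add: a_def)
  have av: "avoids (v # \<sigma> @ [a+1..<a+m+1] @ map f \<tau>) p"
    using old \<sigma>(2) va by (subst (asm) map_bump_dsum) (auto simp: a_def f_def[abs_def] simp del: upt_Suc)
  have cont: "\<not> avoids (v # \<sigma> @ [a+1..<a+m+2] @ map f' \<tau>) p"
    using new \<sigma>(2) va by (subst (asm) map_bump_dsum) (auto simp: a_def f'_def[abs_def] add.assoc simp del: upt_Suc)
  have no: False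
    if "subseq (map g s) (v # \<sigma> @ [a+1..<a+m+1] @ map f \<tau>)" "strict_mono_on (set s) g" "order_iso s p" for g s
    using containedI[OF that] av by blast
  have f'gt: "a + m + 1 < f' t" "f' t \<noteq> v" if "t > 0" for t using that by (auto simp: f'_def bump_def)
  have f'mono: "strict_mono_on A f'" for A by (rule strict_mono_onI) (auto simp: f'_def bump_def)
  have nc: "ncuts p = ncuts s" "ncuts (tl p) = ncuts (tl s)" if "order_iso s p" for s
  proof -
    have "order_iso p s" using that by (rule order_iso_sym)
    then obtain g where g: "strict_mono_on (set p) g" "s = map g p" using order_isoE assms(7) by blast
    have "strict_mono_on (set (tl p)) g"
      using g(1) by (rule monotone_on_subset) (auto intro: list.set_sel(2)[OF p])
    then show "ncuts p = ncuts s" "ncuts (tl p) = ncuts (tl s)"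
      using cuts_map[OF g(1)] cuts_map[of "tl p" g] unfolding ncuts_def g(2) by (simp_all add: map_tl)
  qed
  have A: "ncuts p \<ge> 3 \<or> ncuts (tl p) > ncuts p"
    if "subseq s1 \<sigma>" "subseq s2 [a+1..<a+m+2]" "subseq s0 \<tau>" "v + 1 \<notin> set (map f' s0)"
      "order_iso (v # s1 @ s2 @ map f' s0) p" for s1 s2 s0
  proof -
    \<comment> \<open>\<open>h\<close> turns \<open>f' t\<close> into \<open>f t\<close>. It is
      monotone on the occurrence because \<open>v + 1\<close>, the one value it would send to
      \<open>v\<close>, is absent.\<close>
    define h where "h y = (if y = v then v else y - 1)" for y
    let ?s3 = "map f' s0"
    have pos: "t > 0" if "t \<in> set s0" for t using that \<tau>(2) subseq_set[OF \<open>subseq s0 \<tau>\<close>] by blast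
    have s3: "a + m + 1 < y" "y \<noteq> v" "y \<noteq> v + 1" if y: "y \<in> set ?s3" for y
    proof -
      obtain t where "t \<in> set s0" "y = f' t" using y by auto
      then show "a + m + 1 < y" "y \<noteq> v" using f'gt[of t] pos by auto
      show "y \<noteq> v + 1" using y \<open>v + 1 \<notin> set ?s3\<close> by blast
    qed
    have hf: "h (f' t) = f t" if "t \<in> set s0" for t
    proof -
      have "f' t \<noteq> v" "f' t \<noteq> v + 1" using s3[of "f' t"] that by auto
      then show ?thesis by (auto simp: h_def f_def f'_def bump_def split: if_splits)
    qed
    have sub3: "subseq (map h ?s3) (map f \<tau>)"
      using subseq_map[OF \<open>subseq s0 \<tau>\<close>, of f] hf by (simp add: o_def cong: map_cong)
    have h: "strict_mono_on (set [v] \<union> set ?s3) h"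
    proof (rule strict_mono_onI)
      fix y z assume "y \<in> set [v] \<union> set ?s3" "z \<in> set [v] \<union> set ?s3" "y < z"
      then show "h y < h z" using s3[of y] s3[of z] va by (auto simp: h_def)
    qed
    have hb: "a + m + 1 < y \<and> a + m < h y" if "y \<in> set [v] \<union> set ?s3" for y
      using that s3[of y] va by (auto simp: h_def)
    have hv: "map h [v] = [v]" by (simp add: h_def)
    note mid = occurrence_uses_middle[OF that(1,2) sub3 \<sigma> h hv hb, of p]
    have s2: "s2 = [a+1..<a+m+2]" and s1: "s1 \<noteq> []"
      using mid av that(5) by (simp_all del: upt_Suc)
    have le1: "x \<le> a" if "x \<in> set s1" for x using that \<sigma>(2) subseq_set[OF \<open>subseq s1 \<sigma>\<close>] by blast
    have le2: "a + 1 \<le> x" "x \<le> a + m + 1" if "x \<in> set s2" for x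
      using that by (auto simp: s2 simp del: upt_Suc)
    show ?thesis
    \<comment> \<open>Without entries of \<open>\<tau>\<close> the leading maximum \<open>v\<close>
      ties everything into one component, and removing it leaves at least two. Otherwise removing
      \<open>v\<close> leaves at least three, so (b) holds unless there were already three.\<close>
    proof (cases "s0 = []")
      case True
      have "cuts (v # s1 @ s2) = {length (v # s1 @ s2)}"
        using le1 le2 va by (intro cuts_max_hd) fastforce+
      moreover have "ncuts (s1 @ s2) \<ge> 2" using s1 s2 le1 le2 by (intro two_cuts) fastforce+
      ultimately show ?thesis using nc[OF that(5)] True by (simp add: ncuts_def)
    next
      case False
      have "ncuts (s1 @ s2 @ ?s3) \<ge> 3"
      proof (rule three_cuts)
        show "s1 \<noteq> []" "s2 \<noteq> []" "?s3 \<noteq> []" using s1 s2 False by auto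
        fix x y
        show "x < y" if "x \<in> set s1" "y \<in> set (s2 @ ?s3)"
          using that le1[of x] le2[of y] s3[of y] by (auto simp del: set_map)
        show "x < y" if "x \<in> set s2" "y \<in> set ?s3"
          using that le2[of x] s3[of y] by (auto simp del: set_map)
      qed
      then have "ncuts (tl p) \<ge> 3" using nc(2)[OF that(5)] by simp
      then show ?thesis by linarith
    qed
  qed
  obtain s where s: "subseq s (v # \<sigma> @ [a+1..<a+m+2] @ map f' \<tau>)" "order_iso s p"
    using cont unfolding avoids_def by blast
  have ds: "distinct s" using order_iso_distinct[OF order_iso_sym[OF s(2)]] assms(7) by blast
  show ?thesis
  proof (cases "subseq s (\<sigma> @ [a+1..<a+m+2] @ map f' \<tau>)")
    case True
    \<comment> \<open>An occurrence that fits behind the first position lies in a relabelled copy of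
      \<open>?F\<close>, so the result for decomposable permutations applies.\<close>
    let ?F = "\<sigma> \<oplus> id_perm (m + 1) \<oplus> \<tau>" and ?P = "\<sigma> \<oplus> id_perm m \<oplus> \<tau>"
    have perm: "\<sigma> \<oplus> id_perm k \<oplus> \<tau> \<in> perms (length \<sigma> + (k + length \<tau>))" for k
      using assms(1,2) by (intro dsum_in_perms id_perm_in_perms) (auto simp: is_component_def)
    have "\<sigma> @ [a+1..<a+m+2] @ map f' \<tau> = map (bump v) ?F"
      using \<sigma>(2) va by (subst map_bump_dsum) (auto simp: a_def f'_def[abs_def] add.assoc simp del: upt_Suc)
    then have "\<not> avoids (map (bump v) ?F) p" using True s(2) unfolding avoids_def by auto
    then have "\<not> avoids ?F p"
      using avoids_order_iso[OF order_iso_sym[OF order_iso_map[OF bump_strict_mono]]]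
        order_iso_distinct[OF order_iso_map[OF bump_strict_mono] perms_distinct[OF perm]] by blast
    moreover have "avoids (map (bump v) ?P) p" using avoids_subseq[OF old] by blast
    then have "avoids ?P p" by (rule avoids_map[OF _ bump_strict_mono perms_distinct[OF perm]])
    ultimately have "ncuts p \<ge> 3" using f_tilde_new_occurrence assms(1,2,7) by blast
    then show ?thesis by (simp add: has_property_def)
  next
    case False
    then obtain s' where s': "s = v # s'" "subseq s' (\<sigma> @ [a+1..<a+m+2] @ map f' \<tau>)"
      using s(1) p s(2) by (cases s) (auto simp: order_iso_def split: if_splits)
    obtain s1 s2 s3 where s123: "s' = s1 @ s2 @ s3" "subseq s1 \<sigma>" "subseq s2 [a+1..<a+m+2]"
      "subseq s3 (map f' \<tau>)"
      using s'(2) by (metis subseq_appendE)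
    obtain s0 where s0: "subseq s0 \<tau>" "s3 = map f' s0" using subseq_mapE[OF s123(4)] .
    have pos: "t > 0" if "t \<in> set s0" for t using that \<tau>(2) subseq_set[OF s0(1)] by blast
    have s3: "a + m + 1 < y" "y \<noteq> v" if y: "y \<in> set s3" for y
    proof -
      obtain t where "t \<in> set s0" "y = f' t" using y s0(2) by auto
      then show "a + m + 1 < y" "y \<noteq> v" using f'gt[of t] pos by auto
    qed
    have le1: "x \<le> a + m + 1" if "x \<in> set (s1 @ s2)" for x
      using that \<sigma>(2) subseq_set[OF s123(2)] subseq_set[OF s123(3)] by fastforce
    have iso: "order_iso (v # s1 @ s2 @ s3) p" using s(2) s'(1) s123(1) by simp
    show ?thesis
    proof (cases "v + 1 \<in> set s3")
      case False
      then show ?thesis using A[OF s123(2,3) s0(1)] iso s0(2) by (auto simp: has_property_def)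
    next
      case v1: True
      have "has_property (v < N) s"
      proof (cases "s1 @ s2 = []")
        case True
        \<comment> \<open>The occurrence lies within \<open>v\<close> and \<open>\<tau>\<close>.
          Since it contains \<open>v + 1\<close>, an entry below \<open>v\<close> is all that (d)
          still needs.\<close>
        have "\<exists>y\<in>set s3. y < v"
        proof (rule ccontr)
          assume "\<not> (\<exists>y\<in>set s3. y < v)"
          then have gt: "v < y" if "y \<in> set s3" for y using s3[OF that] that by force
          \<comment> \<open>If \<open>v\<close> is the minimum of the occurrence,
            \<open>hd \<sigma>\<close> can take its place: it precedes \<open>\<tau>\<close> and
            lies below all of it, so it does not matter that \<open>v + 1\<close> falls to
            \<open>v - 1\<close>.\<close>
          define g where "g y = (if y = v then hd \<sigma> else if y = v + 1 then v - 1 else y - 1)" for y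
          have "hd \<sigma> \<le> a" using \<sigma> by simp
          then have "strict_mono_on (set (v # s3)) g"
            using gt va by (intro strict_mono_onI) (fastforce simp: g_def)
          moreover have "g (f' t) = f t" if "t \<in> set s0" for t
            using gt[of "f' t"] that s0(2) by (auto simp: g_def f_def f'_def bump_def split: if_splits)
          then have "map g s3 = map f s0" unfolding s0(2) by simp
          then have "subseq (map g s3) (map f \<tau>)" using subseq_map[OF s0(1)] by simp
          then have "subseq ([] @ [hd \<sigma>] @ [] @ map g s3) ([v] @ \<sigma> @ [a+1..<a+m+1] @ map f \<tau>)"
            using \<sigma>(1) by (intro list_emb_append_mono) (auto simp: subseq_singleton_left)
          then have "subseq (map g (v # s3)) (v # \<sigma> @ [a+1..<a+m+1] @ map f \<tau>)"
            by (simp add: g_def del: upt_Suc)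
          moreover have "order_iso (v # s3) p" using iso True by simp
          ultimately show False using no by blast
        qed
        moreover have "avoids s3 [2, 1, 3]"
        proof (rule avoids_subseq[OF _ s123(4)])
          have "order_iso (map f' \<tau>) \<tau>" by (rule order_iso_sym[OF order_iso_map[OF f'mono]])
          moreover have "distinct (map f' \<tau>)"
            using \<tau>(4) strict_mono_on_imp_inj_on[OF f'mono] by (simp add: distinct_map)
          ultimately show "avoids (map f' \<tau>) [2, 1, 3]" using avoids_order_iso assms(3) by blast
        qed
        ultimately show ?thesis
          using True v1 unfolding s'(1) s123(1) has_property_def by auto
      next
        case u: False
        have s_eq: "s = (v # s1 @ s2) @ s3" using s'(1) s123(1) by simp
        have s3ne: "s3 \<noteq> []" using v1 by auto
        have lo: "\<exists>y\<in>set s. y < hd s"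
          using u le1[of "hd (s1 @ s2)"] va hd_in_set[OF u] unfolding s_eq by (auto intro!: bexI[of _ "hd (s1 @ s2)"])
        show ?thesis
        proof (cases "\<forall>y\<in>set s3. v < y")
          case True
          \<comment> \<open>The entries from \<open>v\<close>, \<open>\<sigma>\<close> and the
            middle form a prefix with maximum \<open>v\<close> that lies below \<open>s3\<close>.
            With exactly two components this prefix is the first one, as (c) demands.\<close>
          let ?i = "length (v # s1 @ s2)"
          have cut: "?i \<in> cuts s"
            unfolding s_eq using True le1 s3 by (intro append_in_cuts) fastforce+
          have "{?i, length s} \<subseteq> cuts s" using cut length_in_cuts[of s] s'(1) by simp
          then have "card {?i, length s} \<le> ncuts s" unfolding ncuts_def by (intro card_mono) auto
          then have n2: "ncuts s \<ge> 2" using s3ne by (simp add: s_eq)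
          have i: "?i < length s" "\<forall>x\<in>set (take ?i s). x \<le> hd s"
            using s3ne le1 va by (fastforce simp: s_eq)+
          show ?thesis
          proof (cases "ncuts s \<ge> 3 \<or> \<not> v < N \<or> (\<exists>y\<in>set s. last s < y)")
            case True
            then show ?thesis using n2 lo cut i unfolding has_property_def by force
          next
            case bad: False
            have last: "last s = last s3" using s3ne by (simp add: s_eq)
            obtain s3' z where z: "s3 = s3' @ [z]" using s3ne by (metis append_butlast_last_id)
            have big: "y \<le> z" if "y \<in> set s" for y using bad last z that by force
            \<comment> \<open>The last entry \<open>z\<close> is the maximum, so it is a component
              by itself; anything before it in \<open>s3\<close> would give a third one.\<close>
            have "s3' = []"
            proof (rule ccontr)
              assume ne: "s3' \<noteq> []"
              have "ncuts ((v # s1 @ s2) @ s3' @ [z]) \<ge> 3"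
              proof (rule three_cuts)
                fix x y
                show "x < y" if "x \<in> set (v # s1 @ s2)" "y \<in> set (s3' @ [z])"
                  using that True le1[of x] s3[of y] unfolding z by fastforce
                show "x < y" if "x \<in> set s3'" "y \<in> set [z]"
                  using that big[of x] ds unfolding s_eq z by (auto simp: le_less)
              qed (use ne in auto)
              then show False using bad by (simp add: s_eq z)
            qed
            then have s3v: "s3 = [v + 1]" using v1 z by auto
            \<comment> \<open>Trading the entry \<open>v + 1\<close> for \<open>v + 2\<close> gives an occurrence to which \<open>A\<close> applies.\<close>
            define t where "t = v - (a + m)"
            \<comment> \<open>The bound \<open>t \<le> length \<tau>\<close> amounts to
              \<open>v < N\<close>; this is where the flag enters.\<close>
            have t: "t \<in> set \<tau>" "f' t = v + 2"
              using va bad v(3) unfolding \<tau>(3) by (auto simp: t_def f'_def bump_def a_def)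
            have "order_iso (v # s1 @ s2 @ map f' [t]) (v # s1 @ s2 @ s3)"
            proof -
              define g where "g y = (if y = v + 1 then v + 2 else y)" for y
              have "map g (s1 @ s2) = s1 @ s2" using le1 va by (intro map_idI) (fastforce simp: g_def)
              then have "map g (v # s1 @ s2 @ s3) = v # s1 @ s2 @ map f' [t]"
                using s3v t(2) by (simp add: g_def)
              moreover have "strict_mono_on (set (v # s1 @ s2 @ s3)) g"
              proof (rule strict_mono_onI)
                fix y z assume "y \<in> set (v # s1 @ s2 @ s3)" "z \<in> set (v # s1 @ s2 @ s3)" "y < z"
                then show "g y < g z" using le1[of y] le1[of z] va s3v by (auto simp: g_def)
              qed
              ultimately show ?thesis using order_iso_map order_iso_sym by metis
            qed
            then have "order_iso (v # s1 @ s2 @ map f' [t]) p" using iso order_iso_trans by blast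
            moreover have "subseq [t] \<tau>" using t(1) by (simp add: subseq_singleton_left)
            ultimately have "ncuts p \<ge> 3 \<or> ncuts (tl p) > ncuts p"
              using A[OF s123(2,3)] t(2) by simp
            then show ?thesis using nc[OF s(2)] unfolding has_property_def by auto
          qed
        next
          case False
          then obtain y0 where y0: "y0 \<in> set s3" "y0 < v" using s3 by fastforce
          let ?t = "(s1 @ s2) @ s3"
          have tl: "tl s = ?t" by (simp add: s_eq)
          have cut: "length (s1 @ s2) \<in> cuts ?t"
            using u le1 s3 by (intro append_in_cuts) fastforce+
          \<comment> \<open>Deleting \<open>v\<close> keeps every cut, one place earlier, and gains
            the cut after \<open>s1 @ s2\<close>. In \<open>s\<close> that cut is blocked, as is the
            one right after \<open>v\<close>, because \<open>v\<close> precedes the smaller entry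
            \<open>y0\<close> of \<open>s3\<close>. Hence (b).\<close>
          have "(\<lambda>i. i - 1) ` cuts s \<subseteq> cuts ?t - {length (s1 @ s2)}"
          proof
            fix j assume "j \<in> (\<lambda>i. i - 1) ` cuts s"
            then obtain i where i: "i \<in> cuts s" "j = i - 1" by blast
            have "i \<noteq> 0" using i by (auto simp: cuts_def)
            then have ij: "i = Suc j" using i by simp
            have td: "take i s = v # take j ?t" "drop i s = drop j ?t" by (simp_all add: ij s_eq)
            have lt: "x < y" if "x \<in> set (v # take j ?t)" "y \<in> set (drop j ?t)" for x y
              using i(1) that unfolding cuts_def td[symmetric] by blast
            have y0t: "y0 \<notin> set (drop j ?t)" using lt[of v y0] y0(2) by (intro notI) simp
            have "j \<noteq> 0"
            proof
              assume e: "j = 0"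
              show False using y0t y0(1) unfolding e by simp
            qed
            moreover have "j \<noteq> length (s1 @ s2)"
            proof
              assume e: "j = length (s1 @ s2)"
              show False using y0t y0(1) unfolding e by simp
            qed
            moreover have "j \<le> length ?t" using i(1) by (simp add: cuts_def ij s_eq)
            moreover have "\<forall>x\<in>set (take j ?t). \<forall>y\<in>set (drop j ?t). x < y" using lt by simp
            ultimately show "j \<in> cuts ?t - {length (s1 @ s2)}"
              by (simp add: cuts_def Suc_le_eq del: take_append drop_append set_append)
          qed
          then have "card ((\<lambda>i. i - 1) ` cuts s) \<le> card (cuts ?t - {length (s1 @ s2)})"
            by (intro card_mono) auto
          also have "\<dots> < card (cuts ?t)" using cut by (intro psubset_card_mono) auto
          also have "card ((\<lambda>i. i - 1) ` cuts s) = ncuts s"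
            unfolding ncuts_def by (intro card_image) (auto simp: inj_on_def cuts_def)
          finally show ?thesis unfolding has_property_def tl ncuts_def by blast
        qed
      qed
      then show ?thesis using has_property_order_iso[OF s(2) ds] s'(1) by blast
    qed
  qed
qed


section \<open>Inverse and reverse-complement\<close>

lemma subseq_indices:
  "subseq s xs \<Longrightarrow> \<exists>f. strict_mono_on {..<length s} f \<and> (\<forall>i<length s. f i < length xs \<and> xs ! f i = s ! i)"
proof (induction rule: list_emb.induct)
  case (list_emb_Nil ys)
  show ?case by (auto simp: monotone_on_def)
next
  case (list_emb_Cons xs ys y)
  then obtain f where f: "strict_mono_on {..<length xs} f" "\<forall>i<length xs. f i < length ys \<and> ys ! f i = xs ! i"
    by blast
  then have "strict_mono_on {..<length xs} (\<lambda>i. Suc (f i))" by (simp add: monotone_on_def)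
  then show ?case using f(2) by (intro exI[of _ "\<lambda>i. Suc (f i)"]) simp
next
  case (list_emb_Cons2 x y xs ys)
  then obtain f where f: "strict_mono_on {..<length xs} f" "\<forall>i<length xs. f i < length ys \<and> ys ! f i = xs ! i"
    by blast
  let ?f = "\<lambda>i. case i of 0 \<Rightarrow> 0 | Suc j \<Rightarrow> Suc (f j)"
  have "strict_mono_on {..<length (x # xs)} ?f"
    using f(1) by (auto simp: monotone_on_def split: nat.splits)
  moreover have "\<forall>i<length (x # xs). ?f i < length (y # ys) \<and> (y # ys) ! ?f i = (x # xs) ! i"
    using f(2) list_emb_Cons2 by (auto split: nat.splits)
  ultimately show ?case by blast
qed

text \<open>The prefix length \<open>k\<close> strengthens the induction: the first \<open>n\<close>
  chosen positions all lie before \<open>f n\<close>.\<close>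

lemma indices_subseq:
  assumes "strict_mono_on {..<n} f" "\<And>i. i < n \<Longrightarrow> f i < k" "k \<le> length xs"
  shows "subseq (map (\<lambda>i. xs ! f i) [0..<n]) (take k xs)"
  using assms
proof (induction n arbitrary: k)
  case (Suc n)
  have mono: "strict_mono_on {..<n} f" by (rule monotone_on_subset[OF Suc.prems(1)]) auto
  have "f i < f n" if "i < n" for i using strict_mono_onD[OF Suc.prems(1)] that by simp
  moreover have fn: "f n < k" using Suc.prems(2) by simp
  ultimately have "subseq (map (\<lambda>i. xs ! f i) [0..<n]) (take (f n) xs)"
    using Suc.IH[OF mono, of "f n"] Suc.prems(3) by simp
  then have "subseq (map (\<lambda>i. xs ! f i) [0..<Suc n]) (take (f n) xs @ [xs ! f n])" by simp
  also have "take (f n) xs @ [xs ! f n] = take (Suc (f n)) xs"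
    using fn Suc.prems(3) by (simp add: take_Suc_conv_app_nth)
  also have "subseq (take (Suc (f n)) xs) (take k xs)"
    using fn by (intro prefix_imp_subseq) (metis Suc_leI min.absorb1 take_is_prefix take_take)
  finally show ?case .
qed simp

text \<open>Inversion exchanges positions with values, so a relabelling of values no longer suffices
  and the embedding of positions must be explicit.\<close>

lemma contained_iff_indices:
  "\<not> avoids \<pi> p \<longleftrightarrow> (\<exists>f. strict_mono_on {..<length p} f \<and> (\<forall>i<length p. f i < length \<pi>) \<and>
     (\<forall>i<length p. \<forall>j<length p. \<pi> ! f i < \<pi> ! f j \<longleftrightarrow> p ! i < p ! j))"
proof
  assume "\<not> avoids \<pi> p"
  then obtain s where s: "subseq s \<pi>" "order_iso s p" unfolding avoids_def by blast
  obtain f where f: "strict_mono_on {..<length s} f"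
    "\<And>i. i < length s \<Longrightarrow> f i < length \<pi> \<and> \<pi> ! f i = s ! i"
    using subseq_indices[OF s(1)] by blast
  have len: "length s = length p" using s(2) by (simp add: order_iso_def)
  show "\<exists>f. strict_mono_on {..<length p} f \<and> (\<forall>i<length p. f i < length \<pi>) \<and>
     (\<forall>i<length p. \<forall>j<length p. \<pi> ! f i < \<pi> ! f j \<longleftrightarrow> p ! i < p ! j)"
    using f s(2) unfolding order_iso_def len by (intro exI[of _ f]) simp
next
  assume "\<exists>f. strict_mono_on {..<length p} f \<and> (\<forall>i<length p. f i < length \<pi>) \<and>
     (\<forall>i<length p. \<forall>j<length p. \<pi> ! f i < \<pi> ! f j \<longleftrightarrow> p ! i < p ! j)"
  then obtain f where f: "strict_mono_on {..<length p} f" "\<forall>i<length p. f i < length \<pi>"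
    "\<forall>i<length p. \<forall>j<length p. \<pi> ! f i < \<pi> ! f j \<longleftrightarrow> p ! i < p ! j" by blast
  then have "subseq (map (\<lambda>i. \<pi> ! f i) [0..<length p]) \<pi>"
    using indices_subseq[of "length p" f "length \<pi>" \<pi>] by simp
  moreover have "order_iso (map (\<lambda>i. \<pi> ! f i) [0..<length p]) p"
    using f(3) by (simp add: order_iso_def)
  ultimately show "\<not> avoids \<pi> p" unfolding avoids_def by blast
qed

section \<open>The action of the two symmetries on containment and decomposability\<close>

lemma perms_nth_bounds:
  assumes "\<pi> \<in> perms n" "i < n"
  shows "1 \<le> \<pi> ! i" "\<pi> ! i \<le> n"
  using assms length_perms[OF assms(1)] nth_mem[of i \<pi>] by (auto simp: perms_iff)

lemma inv_perm_indexE: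
  assumes "\<pi> \<in> perms n" "j < n"
  obtains i where "i < n" "\<pi> ! i = Suc j" "inv_perm \<pi> ! j = Suc i"
proof -
  obtain i where i: "i < n" "\<pi> ! i = Suc j"
    using perms_nth_surj[OF assms(1), of "Suc j"] assms(2) by auto
  then show ?thesis using that inv_perm_nth[OF assms(1) i(1)] by simp
qed

lemma inv_perm_inv_perm:
  assumes "\<pi> \<in> perms n"
  shows "inv_perm (inv_perm \<pi>) = \<pi>"
proof (rule nth_equalityI)
  have len: "length \<pi> = n" using assms length_perms by auto
  fix j assume "j < length (inv_perm (inv_perm \<pi>))"
  then have "j < n" using len by simp
  then obtain i where i: "i < n" "inv_perm \<pi> ! i = Suc j" "inv_perm (inv_perm \<pi>) ! j = Suc i"
    using inv_perm_indexE[OF inv_perm_in_perms[OF assms]] by metis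
  obtain k where k: "k < n" "\<pi> ! k = Suc i" "inv_perm \<pi> ! i = Suc k"
    using inv_perm_indexE[OF assms i(1)] by metis
  then show "inv_perm (inv_perm \<pi>) ! j = \<pi> ! j" using i by simp
qed simp

lemma rc_nth: "i < length \<pi> \<Longrightarrow> rc \<pi> ! i = Suc (length \<pi>) - \<pi> ! (length \<pi> - Suc i)"
  by (simp add: rc_def rev_nth)

lemma rc_rc:
  assumes "\<pi> \<in> perms n"
  shows "rc (rc \<pi>) = \<pi>"
proof -
  have "Suc (length \<pi>) - (Suc (length \<pi>) - x) = x" if "x \<in> set \<pi>" for x
    using that assms length_perms[OF assms] by (auto simp: perms_iff)
  then show ?thesis by (simp add: rc_def rev_map map_idI)
qed

lemma contained_inv_perm:
  assumes "\<pi> \<in> perms N" "p \<in> perms n" "\<not> avoids \<pi> p"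
  shows "\<not> avoids (inv_perm \<pi>) (inv_perm p)"
proof -
  have len: "length \<pi> = N" "length p = n" using assms length_perms by auto
  obtain f where f: "strict_mono_on {..<n} f" "\<And>i. i < n \<Longrightarrow> f i < N"
    "\<And>i j. i < n \<Longrightarrow> j < n \<Longrightarrow> \<pi> ! f i < \<pi> ! f j \<longleftrightarrow> p ! i < p ! j"
    using assms(3) unfolding contained_iff_indices len by blast
  \<comment> \<open>Positions of the inverse are values of the original. So \<open>g\<close> takes
    the entry of \<open>p\<close> with value \<open>Suc j\<close>, follows \<open>f\<close> to its
    image in \<open>\<pi>\<close> and returns the value found there; both subtractions pass from
    values to positions counted from 0.\<close>
  define g where "g j = \<pi> ! f (inv_perm p ! j - 1) - 1" for j
  have key: "\<exists>i<n. p ! i = Suc j \<and> inv_perm p ! j = Suc i \<and> Suc (g j) = \<pi> ! f i \<and> g j < N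
      \<and> inv_perm \<pi> ! g j = Suc (f i)" if j: "j < n" for j
  proof -
    obtain i where i: "i < n" "p ! i = Suc j" "inv_perm p ! j = Suc i"
      using inv_perm_indexE[OF assms(2) j] .
    have "g j = \<pi> ! f i - 1" using i by (simp add: g_def)
    then show ?thesis
      using i perms_nth_bounds[OF assms(1) f(2)[OF i(1)]] inv_perm_nth[OF assms(1) f(2)[OF i(1)]]
      by (intro exI[of _ i]) auto
  qed
  have "strict_mono_on {..<n} g"
  proof (rule strict_mono_onI)
    fix j k assume jk: "j \<in> {..<n}" "k \<in> {..<n}" "j < k"
    obtain i where i: "i < n" "p ! i = Suc j" "Suc (g j) = \<pi> ! f i" using key jk by blast
    obtain i' where i': "i' < n" "p ! i' = Suc k" "Suc (g k) = \<pi> ! f i'" using key jk by blast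
    have "\<pi> ! f i < \<pi> ! f i'" using f(3)[OF i(1) i'(1)] i i' jk by simp
    then show "g j < g k" using i i' by simp
  qed
  moreover have "\<forall>j<n. g j < N" using key by blast
  moreover have "inv_perm \<pi> ! g j < inv_perm \<pi> ! g k \<longleftrightarrow> inv_perm p ! j < inv_perm p ! k"
    if jk: "j < n" "k < n" for j k
  proof -
    obtain i where i: "i < n" "inv_perm p ! j = Suc i" "inv_perm \<pi> ! g j = Suc (f i)"
      using key jk by blast
    obtain i' where i': "i' < n" "inv_perm p ! k = Suc i'" "inv_perm \<pi> ! g k = Suc (f i')"
      using key jk by blast
    show ?thesis using i i' strict_mono_on_less[OF f(1), of i i'] by simp
  qed
  ultimately show ?thesis unfolding contained_iff_indices length_inv_perm len by blast
qed

lemma contained_rc: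
  assumes "\<pi> \<in> perms N" "p \<in> perms n" "\<not> avoids \<pi> p"
  shows "\<not> avoids (rc \<pi>) (rc p)"
proof -
  have len: "length \<pi> = N" "length p = n" using assms length_perms by auto
  obtain f where f: "strict_mono_on {..<n} f" "\<And>i. i < n \<Longrightarrow> f i < N"
    "\<And>i j. i < n \<Longrightarrow> j < n \<Longrightarrow> \<pi> ! f i < \<pi> ! f j \<longleftrightarrow> p ! i < p ! j"
    using assms(3) unfolding contained_iff_indices len by blast
  \<comment> \<open>The embedding \<open>f\<close> read from the right end, in the pattern as well
    as in \<open>\<pi>\<close>.\<close>
  define g where "g j = N - Suc (f (n - Suc j))" for j
  have "strict_mono_on {..<n} g"
  proof (rule strict_mono_onI)
    fix j k assume jk: "j \<in> {..<n}" "k \<in> {..<n}" "j < k"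
    then have "f (n - Suc k) < f (n - Suc j)" by (intro strict_mono_onD[OF f(1)]) auto
    moreover have "f (n - Suc j) < N" using f(2) jk by simp
    ultimately show "g j < g k" by (simp add: g_def)
  qed
  moreover have gN: "g j < N" if "j < n" for j using f(2)[of "n - Suc j"] that by (simp add: g_def)
  moreover have "rc \<pi> ! g j < rc \<pi> ! g k \<longleftrightarrow> rc p ! j < rc p ! k" if jk: "j < n" "k < n" for j k
  proof -
    have 1: "rc p ! j = Suc n - p ! (n - Suc j)" "n - Suc j < n" if "j < n" for j
      using that rc_nth[of j p] len by auto
    have 2: "rc \<pi> ! g j = Suc N - \<pi> ! f (n - Suc j)" if "j < n" for j
      using that rc_nth[of "g j" \<pi>] len gN[OF that] f(2)[of "n - Suc j"] by (simp add: g_def Suc_diff_Suc)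
    have diff: "Suc k - x < Suc k - y \<longleftrightarrow> y < x" if "x \<le> k" "y \<le> k" for x y k :: nat
      using that by auto
    note b = 1(2)[OF jk(1)] 1(2)[OF jk(2)]
    show ?thesis
      unfolding 1(1)[OF jk(1)] 1(1)[OF jk(2)] 2[OF jk(1)] 2[OF jk(2)]
      using f(3)[OF b(2,1)]
      by (simp add: diff perms_nth_bounds(2)[OF assms(2) b(1)] perms_nth_bounds(2)[OF assms(2) b(2)]
        perms_nth_bounds(2)[OF assms(1) f(2)[OF b(1)]] perms_nth_bounds(2)[OF assms(1) f(2)[OF b(2)]])
  qed
  ultimately show ?thesis unfolding contained_iff_indices length_rc len by blast
qed

text \<open>In this form the condition treats positions and values alike, which makes its behaviour
  under both symmetries immediate.\<close>

lemma decomposable_iff_nth: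
  assumes "\<pi> \<in> perms N"
  shows "decomposable \<pi> \<longleftrightarrow> (\<exists>k. 0 < k \<and> k < N \<and> (\<forall>i<N. \<pi> ! i \<le> k \<longleftrightarrow> i < k))"
proof
  have len: "length \<pi> = N" using assms length_perms by auto
  assume "decomposable \<pi>"
  then obtain k where k: "k < N" "k \<in> cuts \<pi>" using decomposable_iff_cut[OF assms] by blast
  obtain \<sigma> \<tau> where st: "\<sigma> \<in> perms k" "\<tau> \<in> perms (N - k)" "\<pi> = \<sigma> \<oplus> \<tau>"
    using cut_split[OF assms k(2,1)] by metis
  have "\<pi> ! i \<le> k \<longleftrightarrow> i < k" if "i < N" for i
  proof (cases "i < k")
    case True
    then show ?thesis
      using st length_perms[OF st(1)] perms_nth_bounds[OF st(1), of i] by (simp add: dsum_def nth_append)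
  next
    case False
    then show ?thesis
      using st length_perms[OF st(1)] length_perms[OF st(2)] perms_nth_bounds(1)[OF st(2), of "i - k"] that
        diff_less_mono[of i N k]
      by (auto simp: dsum_def nth_append)
  qed
  moreover have "0 < k" using k(2) by (simp add: cuts_def)
  ultimately show "\<exists>k. 0 < k \<and> k < N \<and> (\<forall>i<N. \<pi> ! i \<le> k \<longleftrightarrow> i < k)" using k(1) by blast
next
  have len: "length \<pi> = N" using assms length_perms by auto
  assume "\<exists>k. 0 < k \<and> k < N \<and> (\<forall>i<N. \<pi> ! i \<le> k \<longleftrightarrow> i < k)"
  then obtain k where k: "0 < k" "k < N" "\<And>i. i < N \<Longrightarrow> \<pi> ! i \<le> k \<longleftrightarrow> i < k" by blast
  have "x < y" if xy: "x \<in> set (take k \<pi>)" "y \<in> set (drop k \<pi>)" for x y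
  proof -
    obtain i where i: "i < k" "x = \<pi> ! i" using xy(1) len by (auto simp: in_set_conv_nth)
    obtain j where "j < length (drop k \<pi>)" "drop k \<pi> ! j = y"
      using xy(2) unfolding in_set_conv_nth by blast
    then have j: "k + j < N" "y = \<pi> ! (k + j)" using len by auto
    show ?thesis using k(3)[of i] k(3)[of "k + j"] i j k(2) by simp
  qed
  then have "k \<in> cuts \<pi>" using k len by (simp add: cuts_def)
  then show "decomposable \<pi>" using decomposable_iff_cut[OF assms] k(2) by blast
qed

lemma decomposable_inv_perm:
  assumes "\<pi> \<in> perms N" "decomposable \<pi>"
  shows "decomposable (inv_perm \<pi>)"
proof -
  obtain k where k: "0 < k" "k < N" "\<And>i. i < N \<Longrightarrow> \<pi> ! i \<le> k \<longleftrightarrow> i < k"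
    using assms decomposable_iff_nth by blast
  have "inv_perm \<pi> ! j \<le> k \<longleftrightarrow> j < k" if "j < N" for j
    using inv_perm_indexE[OF assms(1) that] k(3) by (metis Suc_le_eq)
  then show ?thesis using k decomposable_iff_nth[OF inv_perm_in_perms[OF assms(1)]] by blast
qed

lemma decomposable_rc:
  assumes "\<pi> \<in> perms N" "decomposable \<pi>"
  shows "decomposable (rc \<pi>)"
proof -
  have len: "length \<pi> = N" using assms length_perms by auto
  obtain k where k: "0 < k" "k < N" "\<And>i. i < N \<Longrightarrow> \<pi> ! i \<le> k \<longleftrightarrow> i < k"
    using assms decomposable_iff_nth by blast
  have "rc \<pi> ! j \<le> N - k \<longleftrightarrow> j < N - k" if "j < N" for j
  proof -
    have "N - Suc j < N" using that by simp
    then show ?thesis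
      using rc_nth[of j \<pi>] len that k(3)[of "N - Suc j"] perms_nth_bounds[OF assms(1), of "N - Suc j"] k(1,2)
      by auto
  qed
  then have "0 < N - k \<and> N - k < N \<and> (\<forall>j<N. rc \<pi> ! j \<le> N - k \<longleftrightarrow> j < N - k)"
    using k(1,2) by simp
  then show ?thesis using decomposable_iff_nth[OF rc_in_perms[OF assms(1)]] by blast
qed

lemma hd_rc: "\<pi> \<noteq> [] \<Longrightarrow> hd (rc \<pi>) = Suc (length \<pi>) - last \<pi>"
  by (simp add: rc_def hd_map hd_rev)

lemma hd_inv_perm:
  assumes "\<pi> \<in> perms N" "\<pi> \<noteq> []"
  shows "hd (inv_perm \<pi>) \<in> {1..N}" "\<pi> ! (hd (inv_perm \<pi>) - 1) = 1"
proof -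
  have len: "length \<pi> = N" using assms length_perms by auto
  then have "0 < N" using assms(2) by auto
  then obtain i where i: "i < N" "\<pi> ! i = Suc 0" "inv_perm \<pi> ! 0 = Suc i"
    using inv_perm_indexE[OF assms(1)] by metis
  moreover have "inv_perm \<pi> \<noteq> []" using len \<open>0 < N\<close> by (metis length_inv_perm length_greater_0_conv)
  ultimately show "hd (inv_perm \<pi>) \<in> {1..N}" "\<pi> ! (hd (inv_perm \<pi>) - 1) = 1"
    by (simp_all add: hd_conv_nth)
qed

text \<open>This keeps the class of 1324-avoiders closed under the two symmetries used in the
  recursion.\<close>

lemma self_inverse_patterns: "inv_perm [1, 3, 2, 4] = [1, 3, 2, 4]" "rc [1, 3, 2, 4] = [1, 3, 2, 4]"
proof -
  have p: "[1, 3, 2, 4] \<in> perms 4" by (auto simp: perms_iff)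
  have "inv_perm [1, 3, 2, 4] ! j = [1, 3, 2, 4] ! j" if "j < 4" for j
  proof -
    have "i < 4 \<Longrightarrow> inv_perm [1, 3, 2, 4] ! ([1, 3, 2, 4] ! i - 1) = Suc i" for i
      by (rule inv_perm_nth[OF p])
    from this[of 0] this[of 1] this[of 2] this[of 3] that show ?thesis
      by (auto simp: less_Suc_eq numeral_eq_Suc)
  qed
  then show "inv_perm [1, 3, 2, 4] = [1, 3, 2, 4]" by (intro nth_equalityI) auto
  show "rc [1, 3, 2, 4] = [1, 3, 2, 4]" by (simp add: rc_def)
qed

lemma avoids_inv_perm:
  assumes "\<pi> \<in> perms N" "p \<in> perms n"
  shows "avoids (inv_perm \<pi>) (inv_perm p) \<longleftrightarrow> avoids \<pi> p"
  using contained_inv_perm[OF assms] contained_inv_perm[OF assms[THEN inv_perm_in_perms]]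
  by (auto simp: inv_perm_inv_perm[OF assms(1)] inv_perm_inv_perm[OF assms(2)])

lemma avoids_rc:
  assumes "\<pi> \<in> perms N" "p \<in> perms n"
  shows "avoids (rc \<pi>) (rc p) \<longleftrightarrow> avoids \<pi> p"
  using contained_rc[OF assms] contained_rc[OF assms[THEN rc_in_perms]]
  by (auto simp: rc_rc[OF assms(1)] rc_rc[OF assms(2)])


section \<open>Reduction to the deletion of the first entry\<close>

text \<open>Containment is transported along the symmetries only between permutations, so values of
  \<open>f_map\<close> must be known to be such.\<close>

lemma f_map_del_hd_in_perms:
  assumes "\<pi> \<in> perms N" "avoids \<pi> [1, 3, 2, 4]" "\<not> decomposable \<pi>" "decomposable (del \<pi> (hd \<pi>))"
  shows "f_map \<pi> \<in> perms (Suc N)"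
proof -
  obtain \<sigma> m \<tau> v where f: "is_component \<sigma>" "is_component \<tau>"
    "f_map \<pi> = v # map (bump v) (\<sigma> \<oplus> id_perm (m + 1) \<oplus> \<tau>)"
    "length \<sigma> + m + 2 \<le> v" "v \<le> N" "N = length \<sigma> + m + length \<tau> + 1"
    using f_map_del_hd_form[OF assms] by metis
  have "\<sigma> \<oplus> id_perm (m + 1) \<oplus> \<tau> \<in> perms (length \<sigma> + (m + 1 + length \<tau>))"
    using f(1,2) by (intro dsum_in_perms id_perm_in_perms) (auto simp: is_component_def)
  moreover have "length \<sigma> + (m + 1 + length \<tau>) = N" using f(6) by simp
  ultimately have "\<sigma> \<oplus> id_perm (m + 1) \<oplus> \<tau> \<in> perms N" by simp
  then show ?thesis unfolding f(3) using f(4,5) by (intro Cons_bump_in_perms) auto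
qed

lemma has_property_del_hd:
  assumes "\<pi> \<in> perms N" "avoids \<pi> [1, 3, 2, 4]" "\<not> decomposable \<pi>" "decomposable (del \<pi> (hd \<pi>))"
    "p \<in> perms n" "avoids \<pi> p" "\<not> avoids (f_map \<pi>) p"
  shows "has_property (hd \<pi> < N) p"
proof -
  obtain \<sigma> m \<tau> v where f: "is_component \<sigma>" "is_component \<tau>" "avoids \<tau> [2, 1, 3]"
    "\<pi> = v # map (bump v) (\<sigma> \<oplus> id_perm m \<oplus> \<tau>)"
    "f_map \<pi> = v # map (bump v) (\<sigma> \<oplus> id_perm (m + 1) \<oplus> \<tau>)"
    "length \<sigma> + m + 2 \<le> v" "v \<le> N" "N = length \<sigma> + m + length \<tau> + 1"
    using f_map_del_hd_form[OF assms(1-4)] by metis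
  have "p \<noteq> []" using assms(6) by (auto simp: avoids_def order_iso_def)
  moreover have "hd \<pi> = v" using f(4) by simp
  ultimately show ?thesis
    using has_property_new_occurrence[OF f(1-3,6-8) perms_distinct[OF assms(5)]] assms(6,7) f(4,5) by metis
qed

text \<open>Collects what is needed to apply the results on deleting the first entry to the
  inverse.\<close>

lemma inv_case:
  assumes "\<pi> \<in> perms N" "avoids \<pi> [1, 3, 2, 4]" "\<not> decomposable \<pi>"
    "\<not> decomposable (del \<pi> (hd \<pi>))" "decomposable (del \<pi> 1)"
  shows "inv_perm \<pi> \<in> perms N" "avoids (inv_perm \<pi>) [1, 3, 2, 4]" "\<not> decomposable (inv_perm \<pi>)"
    "decomposable (del (inv_perm \<pi>) (hd (inv_perm \<pi>)))" "f_map \<pi> = inv_perm (f_map (inv_perm \<pi>))"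
proof -
  show \<rho>: "inv_perm \<pi> \<in> perms N" by (rule inv_perm_in_perms[OF assms(1)])
  have "almost_decomposable \<pi>"
    using assms perms_length unfolding almost_decomposable_def by blast
  then show "f_map \<pi> = inv_perm (f_map (inv_perm \<pi>))" using assms by (subst f_map.simps) simp
  show "decomposable (del (inv_perm \<pi>) (hd (inv_perm \<pi>)))" by (rule decomposable_del_inv_perm[OF assms(1,5)])
  show "\<not> decomposable (inv_perm \<pi>)"
    using decomposable_inv_perm[OF \<rho>] inv_perm_inv_perm[OF assms(1)] assms(3) by auto
  have p4: "[1, 3, 2, 4] \<in> perms 4" by (auto simp: perms_iff)
  show "avoids (inv_perm \<pi>) [1, 3, 2, 4]"
    using avoids_inv_perm[OF assms(1) p4] assms(2) self_inverse_patterns by simp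
qed

lemma f_map_del_1_in_perms:
  assumes "\<pi> \<in> perms N" "avoids \<pi> [1, 3, 2, 4]" "\<not> decomposable \<pi>"
    "\<not> decomposable (del \<pi> (hd \<pi>))" "decomposable (del \<pi> 1)"
  shows "f_map \<pi> \<in> perms (Suc N)"
  unfolding inv_case(5)[OF assms]
  by (intro inv_perm_in_perms f_map_del_hd_in_perms inv_case(1-4)[OF assms])

lemma has_property_del_1:
  assumes "\<pi> \<in> perms N" "avoids \<pi> [1, 3, 2, 4]" "\<not> decomposable \<pi>"
    "\<not> decomposable (del \<pi> (hd \<pi>))" "decomposable (del \<pi> 1)"
    "p \<in> perms n" "avoids \<pi> p" "\<not> avoids (f_map \<pi>) p"
  shows "has_property (hd (inv_perm \<pi>) < N) (inv_perm p)"
proof (rule has_property_del_hd[OF inv_case(1-4)[OF assms(1-5)] inv_perm_in_perms[OF assms(6)]])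
  have "f_map (inv_perm \<pi>) \<in> perms (Suc N)"
    by (rule f_map_del_hd_in_perms[OF inv_case(1-4)[OF assms(1-5)]])
  from avoids_inv_perm[OF this inv_perm_in_perms[OF assms(6)]]
  show "\<not> avoids (f_map (inv_perm \<pi>)) (inv_perm p)"
    using assms(8) unfolding inv_case(5)[OF assms(1-5)] inv_perm_inv_perm[OF assms(6)] by simp
  show "avoids (inv_perm \<pi>) (inv_perm p)" using avoids_inv_perm[OF assms(1,6)] assms(7) by blast
qed

text \<open>The choices of q mirror the branches of \<open>f_map\<close>: a decomposable
  \<open>\<pi>\<close> or a deletion of its first entry concerns \<open>p\<close>, a deletion of 1
  the inverse, and in the last branch the same two deletions occur for
  \<open>rc \<pi>\<close>.\<close>

lemma has_property_cases:
  assumes "p \<in> perms n" "\<not> f_compatible p"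
  shows "has_property False p \<or> has_property False (inv_perm p) \<or>
    has_property True (rc p) \<or> has_property True (inv_perm (rc p))"
proof -
  have weaken: "has_property False q" if "has_property c q" for c q
    using that unfolding has_property_def by blast
  obtain \<pi> where \<pi>: "\<pi> \<in> perms (length \<pi>)" "avoids \<pi> [1, 3, 2, 4]" "avoids \<pi> p"
    "decomposable \<pi> \<or> almost_decomposable \<pi>" "\<not> avoids (f_map \<pi>) p"
    using assms(2) unfolding f_compatible_def Av_def by blast
  define N where "N = length \<pi>"
  have \<pi>N: "\<pi> \<in> perms N" using \<pi>(1) by (simp add: N_def)
  consider (dec) "decomposable \<pi>"
    | (first) "\<not> decomposable \<pi>" "decomposable (del \<pi> (hd \<pi>))"
    | (inv) "\<not> decomposable \<pi>" "\<not> decomposable (del \<pi> (hd \<pi>))" "decomposable (del \<pi> 1)"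
    | (rev) "\<not> decomposable \<pi>" "\<not> decomposable (del \<pi> (hd \<pi>))" "\<not> decomposable (del \<pi> 1)"
    by blast
  then show ?thesis
  proof cases
    case dec
    obtain \<sigma> m \<tau> where st: "is_component \<sigma>" "avoids \<sigma> [1, 3, 2]" "is_component \<tau>"
      "avoids \<tau> [2, 1, 3]" "\<pi> = \<sigma> \<oplus> id_perm m \<oplus> \<tau>"
      using decomposable_1324_avoider[OF \<pi>N dec \<pi>(2)] by metis
    have "f_map \<pi> = f_tilde \<pi>" using dec by (subst f_map.simps) simp
    also have "\<dots> = \<sigma> \<oplus> id_perm (m + 1) \<oplus> \<tau>" unfolding st(5) by (rule f_tilde_eq) fact+
    finally have "ncuts p \<ge> 3"
      using f_tilde_new_occurrence[OF st(1,3) perms_distinct[OF assms(1)]] \<pi>(3,5) st(5) by metis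
    then show ?thesis by (simp add: has_property_def)
  next
    case first
    then show ?thesis using has_property_del_hd[OF \<pi>N \<pi>(2) _ _ assms(1) \<pi>(3,5)] weaken by blast
  next
    case inv
    then show ?thesis using has_property_del_1[OF \<pi>N \<pi>(2) _ _ _ assms(1) \<pi>(3,5)] weaken by blast
  next
    case rev
    let ?\<rho> = "rc \<pi>"
    \<comment> \<open>The empty permutation is neither decomposable nor almost decomposable, since
      it cannot supply two nonempty summands.\<close>
    have ne: "\<pi> \<noteq> []" using \<pi>(3,5) rev \<pi>(4)
      by (auto simp: almost_decomposable_def decomposable_def del_def std_def dsum_def)
    have ad: "almost_decomposable \<pi>" using \<pi>(4) rev by blast
    then have f: "f_map \<pi> = rc (f_map ?\<rho>)" using rev by (subst f_map.simps) simp
    have \<rho>: "?\<rho> \<in> perms N" by (rule rc_in_perms[OF \<pi>N])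
    have ind: "\<not> decomposable ?\<rho>" using decomposable_rc[OF \<rho>] rc_rc[OF \<pi>N] rev(1) by auto
    have p4: "[1, 3, 2, 4] \<in> perms 4" by (auto simp: perms_iff)
    have av: "avoids ?\<rho> [1, 3, 2, 4]"
      using avoids_rc[OF \<pi>N p4] \<pi>(2) self_inverse_patterns by simp
    have rcp: "rc p \<in> perms n" by (rule rc_in_perms[OF assms(1)])
    have avp: "avoids ?\<rho> (rc p)" using avoids_rc[OF \<pi>N assms(1)] \<pi>(3) by simp
    have last: "last \<pi> \<in> {1..N}" using \<pi>N last_in_set[OF ne] by (simp add: perms_iff)
    have hd: "hd \<pi> \<in> {1..N}" using \<pi>N hd_in_set[OF ne] by (simp add: perms_iff)
    have hd\<rho>: "hd ?\<rho> = Suc N - last \<pi>" using hd_rc[OF ne] by (simp add: N_def)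
    have N1: "1 \<le> N" using last by simp
    have "decomposable (del \<pi> N) \<or> decomposable (del \<pi> (last \<pi>))"
      using ad rev unfolding almost_decomposable_def N_def by blast
    then have cases: "decomposable (del ?\<rho> 1) \<or> decomposable (del ?\<rho> (hd ?\<rho>))"
      using decomposable_del_rc[OF \<pi>N, of N] decomposable_del_rc[OF \<pi>N, of "last \<pi>"] last N1 hd\<rho> by auto
    \<comment> \<open>Pulled back to \<open>\<pi>\<close>, a deletion can contradict the fact that
      the last branch of \<open>f_map\<close> was reached.\<close>
    have undo: "decomposable (del \<pi> (Suc N - e))" if "decomposable (del ?\<rho> e)" "e \<in> {1..N}" for e
      using decomposable_del_rc[OF \<rho> that] rc_rc[OF \<pi>N] by simp
    have contained: "\<not> avoids (f_map ?\<rho>) (rc p)" if "f_map ?\<rho> \<in> perms (Suc N)"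
      using \<pi>(5) avoids_rc[OF that rcp] unfolding f rc_rc[OF assms(1)] by simp
    show ?thesis
    proof (cases "decomposable (del ?\<rho> (hd ?\<rho>))")
      case True
      \<comment> \<open>This is what provides the extra requirement of (c): if the first entry were maximal, the
        case \<open>decomposable (del \<pi> 1)\<close> would apply.\<close>
      have "hd ?\<rho> \<noteq> N"
        using undo[of "hd ?\<rho>"] True rev(3) N1 by auto
      then have "hd ?\<rho> < N" using hd\<rho> last by auto
      then show ?thesis
        using has_property_del_hd[OF \<rho> av ind True rcp avp contained]
          f_map_del_hd_in_perms[OF \<rho> av ind True] by simp
    next
      case False
      then have one: "decomposable (del ?\<rho> 1)" using cases by blast
      have \<rho>ne: "?\<rho> \<noteq> []" using ne by (simp add: rc_def)
      have f\<rho>: "f_map ?\<rho> \<in> perms (Suc N)" by (rule f_map_del_1_in_perms[OF \<rho> av ind False one])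
      \<comment> \<open>Otherwise \<open>rc \<pi>\<close> ends with 1 and \<open>\<pi>\<close>
        begins with \<open>N\<close>. The deletion of 1 from \<open>rc \<pi>\<close> then
        corresponds to that of the first entry of \<open>\<pi>\<close>, which belongs to an earlier
        branch.\<close>
      have "hd (inv_perm ?\<rho>) \<noteq> N"
      proof
        assume "hd (inv_perm ?\<rho>) = N"
        then have "?\<rho> ! (N - 1) = 1" using hd_inv_perm(2)[OF \<rho> \<rho>ne] by simp
        moreover have "?\<rho> ! (N - 1) = Suc N - hd \<pi>"
          using rc_nth[of "N - 1" \<pi>] N1 ne by (simp add: N_def hd_conv_nth)
        ultimately have "hd \<pi> = N" using hd by auto
        then show False using undo[OF one] N1 rev(2) by simp
      qed
      then have "hd (inv_perm ?\<rho>) < N" using hd_inv_perm(1)[OF \<rho> \<rho>ne] by simp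
      then show ?thesis
        using has_property_del_1[OF \<rho> av ind False one rcp avp contained[OF f\<rho>]] by simp
    qed
  qed
qed

text \<open>The way back from cuts of sequences to components of a permutation, where an entry
  smaller or larger than a given one becomes a comparison with 1 or \<open>n\<close>.\<close>

lemma has_property_perm:
  assumes "q \<in> perms n" "q \<noteq> []" "has_property c q"
  shows "num_components q \<ge> 3
    \<or> num_components (del q (hd q)) > num_components q
    \<or> (hd q > 1 \<and> num_components q = 2 \<and>
        hd (hd (components q)) = Max (set (hd (components q))) \<and> (c \<longrightarrow> last q < n))
    \<or> (1 < hd q \<and> hd q < n \<and> avoids (del q (hd q)) [2, 1, 3])"
proof -
  have d: "del q (hd q) \<in> perms (n - 1)" "order_iso (del q (hd q)) (tl q)"
    using del_in_perms[OF assms(1,2)] by auto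
  have nd: "num_components (del q (hd q)) = ncuts (tl q)"
    using num_components_eq[OF d(1)] cuts_order_iso[OF d(2) perms_distinct[OF d(1)]] by (simp add: ncuts_def)
  have n: "num_components q = ncuts q" by (rule num_components_eq[OF assms(1)])
  have lo: "1 < hd q" if "\<exists>y\<in>set q. y < hd q" using that assms(1) by (fastforce simp: perms_iff)
  have up: "x < n" if "\<exists>y\<in>set q. x < y" for x using that assms(1) by (fastforce simp: perms_iff)
  have av: "avoids (del q (hd q)) [2, 1, 3]" if "avoids (tl q) [2, 1, 3]"
    using avoids_order_iso[OF d(2) perms_distinct[OF d(1)] that] .
  have mx: "hd (hd (components q)) = Max (set (hd (components q)))"
    if n2: "ncuts q = 2" and ex: "\<exists>i\<in>cuts q. i < length q \<and> (\<forall>x\<in>set (take i q). x \<le> hd q)"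
  proof -
    obtain i where i: "i \<in> cuts q" "i < length q" "\<forall>x\<in>set (take i q). x \<le> hd q" using ex by blast
    have c: "hd (components q) = take i q"
      using hd_components[OF assms(1) n2 i(1)] i(2) length_perms[OF assms(1)] by simp
    have "0 < i" using i(1) by (simp add: cuts_def)
    then have "hd (take i q) = hd q" "take i q \<noteq> []" using assms(2) by simp_all
    then have "Max (set (take i q)) = hd q" using i(3) hd_in_set[of "take i q"] by (intro Max_eqI) auto
    then show ?thesis using c \<open>hd (take i q) = hd q\<close> by simp
  qed
  show ?thesis using assms(3) lo up av mx unfolding has_property_def n nd by metis
qed

theorem theorem6p6:
  fixes p :: "nat list" and n :: nat
  assumes "p \<in> perms n" and "avoids p [1, 3, 2, 4]"
    and "\<not> f_compatible p"
  shows "\<exists>(q, via_rc) \<in> {(p, False), (inv_perm p, False), (rc p, True), (inv_perm (rc p), True)}.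
      num_components q \<ge> 3
    \<or> num_components (del q (hd q)) > num_components q
    \<or> (hd q > 1 \<and> num_components q = 2 \<and>
        hd (hd (components q)) = Max (set (hd (components q))) \<and>
        (via_rc \<longrightarrow> last q < n))
    \<or> (1 < hd q \<and> hd q < n \<and> avoids (del q (hd q)) [2, 1, 3])"
proof -
  \<comment> \<open>Every permutation contains the empty pattern, so that pattern is vacuously
    compatible.\<close>
  have "p \<noteq> []"
    using assms(3) by (auto simp: f_compatible_def Av_def avoids_def order_iso_def)
  then have n: "q \<noteq> []" if "q \<in> perms n" for q
    using that perms_not_Nil[OF assms(1)] perms_not_Nil[OF that] by simp
  note q = inv_perm_in_perms[OF assms(1)] rc_in_perms[OF assms(1)]
  consider "has_property False p" | "has_property False (inv_perm p)"
    | "has_property True (rc p)" | "has_property True (inv_perm (rc p))"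
    using has_property_cases[OF assms(1,3)] by blast
  then show ?thesis
  proof cases
    case 1
    from has_property_perm[OF assms(1) n[OF assms(1)] this]
    show ?thesis by (intro bexI[of _ "(p, False)"]) auto
  next
    case 2
    from has_property_perm[OF q(1) n[OF q(1)] this]
    show ?thesis by (intro bexI[of _ "(inv_perm p, False)"]) auto
  next
    case 3
    from has_property_perm[OF q(2) n[OF q(2)] this]
    show ?thesis by (intro bexI[of _ "(rc p, True)"]) auto
  next
    case 4
    note q4 = inv_perm_in_perms[OF q(2)]
    from has_property_perm[OF q4 n[OF q4] 4]
    show ?thesis by (intro bexI[of _ "(inv_perm (rc p), True)"]) auto
  qed
qed

end
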